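(* The $D_4^{\pm}$-singularities do not occur on pseudospherical surfaces, either in the wave front or the non-wave front case. That is, if $f:S\to\mathbb R^3$ is a pseudospherical surface (associated to a Lorentzian-harmonic map $N:S\to\mathbb S^2$), then $f$ has no $D_4^{+}$- or $D_4^-$-singularity at any point $p\in S$, whether or not $f$ is a wave front at $p$.
   Context: Let $S$ be a simply connected Lorentz surface. A smooth map $N:S\to\mathbb S^2\subset\mathbb R^3$ is Lorentzian-harmonic if $N\times N_{xy}=0$ in any null coordinates $(x,y)$. The pseudospherical surface associated to $N$ is the map $f:S\to\mathbb R^3$, unique up to translation, satisfying $f_x=N\times N_x$, $f_y=-N\times N_y$. It is a frontal with unit normal $N$. It is a wave front at a point if the map $(f,N):S\to\mathbb R^3\times\mathbb S^2$ is an immersion there. The surface $f$ has a $D_4^{\pm}$-singularity at $p$ if near $p$ it is locally diffeomorphic (by diffeomorphism germs of source and target) to the map $(s,t)\mapsto(st,\;s^2\mp3t^2,\;s^2t\mp t^3)$ at the origin. *)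

theory Defs
  imports "HOL-Analysis.Analysis"
begin

section \<open>Smooth maps between open sets of normed spaces\<close>

(* Meant for open S (and finite-dimensional 'a): only the values of f on S matter, and the
   directional derivatives of f are again required to be differentiable n times. *)
primrec Ck_on :: "nat \<Rightarrow> 'a::real_normed_vector set \<Rightarrow> ('a \<Rightarrow> 'b::real_normed_vector) \<Rightarrow> bool" where
  "Ck_on 0 S f \<longleftrightarrow> continuous_on S f"
| "Ck_on (Suc n) S f \<longleftrightarrow>
     (\<forall>x\<in>S. f differentiable (at x)) \<and> (\<forall>v. Ck_on n S (\<lambda>x. frechet_derivative f (at x) v))"

definition smooth_on :: "'a::real_normed_vector set \<Rightarrow> ('a \<Rightarrow> 'b::real_normed_vector) \<Rightarrow> bool" where
  "smooth_on S f \<longleftrightarrow> (\<forall>n. Ck_on n S f)"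

definition diffeomorphism :: "'a::real_normed_vector set \<Rightarrow> 'b::real_normed_vector set \<Rightarrow> ('a \<Rightarrow> 'b) \<Rightarrow> bool" where
  "diffeomorphism V W \<Phi> \<longleftrightarrow> open V \<and> open W \<and> bij_betw \<Phi> V W \<and>
     smooth_on V \<Phi> \<and> smooth_on W (inv_into V \<Phi>)"

section \<open>Smooth surfaces\<close>

(* The underlying space of a surface is a whole type 'a, Hausdorff and second countable by its
   type class.  A chart is a pair (U, \<phi>) of its domain and its coordinate map;
   the values of \<phi> outside U are irrelevant. *)
type_synonym 'a chart = "'a set \<times> ('a \<Rightarrow> real \<times> real)"

definition is_chart :: "'a::topological_space chart \<Rightarrow> bool" where
  "is_chart c \<longleftrightarrow> open (fst c) \<and> open (snd c ` fst c) \<and>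
     homeomorphism (fst c) (snd c ` fst c) (snd c) (inv_into (fst c) (snd c))"

definition in_chart :: "'a chart \<Rightarrow> ('a \<Rightarrow> 'b) \<Rightarrow> real \<times> real \<Rightarrow> 'b" where
  "in_chart c f = f \<circ> inv_into (fst c) (snd c)"

definition transition :: "'a chart \<Rightarrow> 'a chart \<Rightarrow> real \<times> real \<Rightarrow> real \<times> real" where
  "transition c d = in_chart c (snd d)"

definition compatible :: "'a chart \<Rightarrow> 'a chart \<Rightarrow> bool" where
  "compatible c d \<longleftrightarrow>
     smooth_on (snd c ` (fst c \<inter> fst d)) (transition c d) \<and>
     smooth_on (snd d ` (fst c \<inter> fst d)) (transition d c)"

definition smooth_atlas :: "'a::topological_space chart set \<Rightarrow> bool" where
  "smooth_atlas A \<longleftrightarrow> (\<forall>c\<in>A. is_chart c) \<and> (\<Union>c\<in>A. fst c) = UNIV \<and> (\<forall>c\<in>A. \<forall>d\<in>A. compatible c d)"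

(* The maximal atlas generated by A. *)
definition smooth_charts :: "'a::topological_space chart set \<Rightarrow> 'a chart set" where
  "smooth_charts A = {c. is_chart c \<and> (\<forall>d\<in>A. compatible c d)}"

definition transition_deriv :: "'a chart \<Rightarrow> 'a chart \<Rightarrow> 'a \<Rightarrow> real \<times> real \<Rightarrow> real \<times> real" where
  "transition_deriv c d p = frechet_derivative (transition c d) (at (snd c p))"

definition det2 :: "(real \<times> real \<Rightarrow> real \<times> real) \<Rightarrow> real" where
  "det2 L = fst (L (1, 0)) * snd (L (0, 1)) - fst (L (0, 1)) * snd (L (1, 0))"

definition same_orientation :: "'a chart \<Rightarrow> 'a chart \<Rightarrow> bool" where
  "same_orientation c d \<longleftrightarrow> (\<forall>p \<in> fst c \<inter> fst d. det2 (transition_deriv c d p) > 0)"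

definition oriented_atlas :: "'a::topological_space chart set \<Rightarrow> bool" where
  "oriented_atlas A \<longleftrightarrow> smooth_atlas A \<and> (\<forall>c\<in>A. \<forall>d\<in>A. same_orientation c d)"

definition smooth_map :: "'a::topological_space chart set \<Rightarrow> ('a \<Rightarrow> 'b::real_normed_vector) \<Rightarrow> bool" where
  "smooth_map A f \<longleftrightarrow> (\<forall>c\<in>smooth_charts A. smooth_on (snd c ` fst c) (in_chart c f))"

section \<open>Lorentz surfaces and null coordinates\<close>

(* A metric is given by its components: g c p v w is the product of the two tangent vectors at p
   whose coordinates in the chart c are v and w.  In dimension two, an orthonormal pair
   with squares 1 and -1 is a basis, so it expresses signature (1,1). *)
type_synonym 'a metric = "'a chart \<Rightarrow> 'a \<Rightarrow> real \<times> real \<Rightarrow> real \<times> real \<Rightarrow> real"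

definition lorentz_metric :: "'a::topological_space chart set \<Rightarrow> 'a metric \<Rightarrow> bool" where
  "lorentz_metric A g \<longleftrightarrow>
     (\<forall>c\<in>smooth_charts A.
        (\<forall>p\<in>fst c. bilinear (g c p) \<and> (\<forall>v w. g c p v w = g c p w v) \<and>
           (\<exists>e1 e2. g c p e1 e1 = 1 \<and> g c p e2 e2 = -1 \<and> g c p e1 e2 = 0)) \<and>
        (\<forall>v w. smooth_on (snd c ` fst c) (in_chart c (\<lambda>p. g c p v w)))) \<and>
     (\<forall>c\<in>smooth_charts A. \<forall>d\<in>smooth_charts A. \<forall>p \<in> fst c \<inter> fst d. \<forall>v w.
        g c p v w = g d p (transition_deriv c d p v) (transition_deriv c d p w))"

(* A Lorentz surface carries an orientation and a conformal class of Lorentzian metrics.  The class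
   is given by a representative g; null coordinates and everything built on them
   are unchanged when g is multiplied by a positive function. *)
definition lorentz_surface :: "'a::topological_space chart set \<Rightarrow> 'a metric \<Rightarrow> bool" where
  "lorentz_surface A g \<longleftrightarrow> oriented_atlas A \<and> lorentz_metric A g"

definition null_coordinates :: "'a::topological_space chart set \<Rightarrow> 'a metric \<Rightarrow> 'a chart \<Rightarrow> bool" where
  "null_coordinates A g c \<longleftrightarrow> c \<in> smooth_charts A \<and>
     (\<forall>p\<in>fst c. g c p (1, 0) (1, 0) = 0 \<and> g c p (0, 1) (0, 1) = 0)"

(* The metric is 2 F dx dy with F > 0 and (x,y) is positively oriented.  This makes the order of the
   two null directions the same in all proper null charts.  Without such a convention the system
   f_x = N \<times> N_x, f_y = - N \<times> N_y would not be coordinate independent: exchanging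
   x and y replaces f by -f. *)
definition proper_null_coordinates :: "'a::topological_space chart set \<Rightarrow> 'a metric \<Rightarrow> 'a chart \<Rightarrow> bool" where
  "proper_null_coordinates A g c \<longleftrightarrow> null_coordinates A g c \<and>
     (\<forall>p\<in>fst c. g c p (1, 0) (0, 1) > 0) \<and> (\<forall>d\<in>A. same_orientation c d)"

section \<open>Lorentzian-harmonic maps and pseudospherical surfaces\<close>

definition pdx :: "(real \<times> real \<Rightarrow> real^3) \<Rightarrow> real \<times> real \<Rightarrow> real^3" where
  "pdx h z = vector_derivative (\<lambda>x. h (x, snd z)) (at (fst z))"

definition pdy :: "(real \<times> real \<Rightarrow> real^3) \<Rightarrow> real \<times> real \<Rightarrow> real^3" where
  "pdy h z = vector_derivative (\<lambda>y. h (fst z, y)) (at (snd z))"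

definition lorentzian_harmonic :: "'a::topological_space chart set \<Rightarrow> 'a metric \<Rightarrow> ('a \<Rightarrow> real^3) \<Rightarrow> bool" where
  "lorentzian_harmonic A g N \<longleftrightarrow> smooth_map A N \<and> range N \<subseteq> sphere 0 1 \<and>
     (\<forall>c. null_coordinates A g c \<longrightarrow>
        (\<forall>z \<in> snd c ` fst c. cross3 (in_chart c N z) (pdy (pdx (in_chart c N)) z) = 0))"

definition pseudospherical_surface ::
  "'a::topological_space chart set \<Rightarrow> 'a metric \<Rightarrow> ('a \<Rightarrow> real^3) \<Rightarrow> ('a \<Rightarrow> real^3) \<Rightarrow> bool" where
  "pseudospherical_surface A g N f \<longleftrightarrow> smooth_map A f \<and>
     (\<forall>c. proper_null_coordinates A g c \<longrightarrow>
        (\<forall>z \<in> snd c ` fst c.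
           pdx (in_chart c f) z = cross3 (in_chart c N z) (pdx (in_chart c N) z) \<and>
           pdy (in_chart c f) z = - cross3 (in_chart c N z) (pdy (in_chart c N) z)))"

section \<open>\<open>D\<^sub>4\<close>-singularities\<close>

(* sg = 1 is the normal form of D_4^+, and sg = -1 that of D_4^-. *)
definition D4_model :: "real \<Rightarrow> real \<times> real \<Rightarrow> real^3" where
  "D4_model sg = (\<lambda>(s, t). vector [s * t, s^2 - sg * 3 * t^2, s^2 * t - sg * t^3])"

(* A diffeomorphism germ of the source taking p to the origin of the plane is a smooth chart c
   centred at p; the target germ is represented by \<Phi>. *)
definition D4_singularity :: "'a::topological_space chart set \<Rightarrow> real \<Rightarrow> ('a \<Rightarrow> real^3) \<Rightarrow> 'a \<Rightarrow> bool" where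
  "D4_singularity A sg f p \<longleftrightarrow>
     (\<exists>c\<in>smooth_charts A. \<exists>V W \<Phi>. p \<in> fst c \<and> snd c p = (0, 0) \<and>
        diffeomorphism V W \<Phi> \<and> f p \<in> V \<and> \<Phi> (f p) = 0 \<and> f ` fst c \<subseteq> V \<and>
        (\<forall>q \<in> fst c. \<Phi> (f q) = D4_model sg (snd c q)))"

abbreviation "D4_plus_singularity A \<equiv> D4_singularity A 1"
abbreviation "D4_minus_singularity A \<equiv> D4_singularity A (-1)"

end

(*
The conditions on N and f are imposed only in proper null charts, so one first needs such a chart
about each point.  A null direction field (1, m) of the metric in an arbitrary chart is
straightened by (x, y) |-> (x, phi (x, y)) with phi_x = m (x, phi) and phi (0, y) = y; straightening
one null direction, exchanging the coordinates and straightening the other one gives null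
coordinates, since the second step preserves the first axis direction, and reflections fix the signs.

In proper null coordinates the equations show that N is orthogonal to the image of df, and that
dN vanishes wherever df does.  Both conclusions hold in every chart.

In the chart of a D_4-singularity f = Theta o D with D the normal form and Theta a diffeomorphism.
Put n_i = N . dTheta (e_i).  Along the axis t = 0 orthogonality reads n_2 = 0 and n_1 + s n_3 = 0
for s <> 0.  Since D is constant to first order at the origin and dN = 0 there, dn_1/ds = 0 at s = 0,
hence n_1 = n_2 = n_3 = 0 at the origin and N = 0, contradicting |N| = 1.
*)

theory Submission
  imports Defs
begin

section \<open>Calculus of smooth maps\<close>

text \<open>Orthogonality of \<open>N\<close> to the image of df alone does not exclude the normal
  form, which is a wave front: its own normal direction (-s, -t/2, 1) satisfies n_1 + s n_3 = 0 on
  the axis, with n_3 nonzero at the origin and n_1 of slope -n_3 there. What a pseudospherical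
  surface forbids is this slope. Where df = 0, the equations make N_x and N_y parallel to N, and |N|
  = 1 makes them orthogonal to N, so dN = 0. The pair (f, N) is then no immersion, and one argument
  serves fronts and other frontals. Most of the work goes into proper null charts, and there the
  obstacle is smooth dependence of the flow phi on its initial value. The quotient of the difference
  of two solutions by the difference of their initial values is the exponential of an integral; its
  limit on the diagonal is phi_y = E = exp (integral of m_y along the solution). Positivity of E
  makes the straightening map injective, and E is as regular as phi, so smoothness can be
  bootstrapped.\<close>

lemma frechet_derivative_cong_open:
  assumes "open S" "x \<in> S" "\<And>y. y \<in> S \<Longrightarrow> f y = g y"
  shows "frechet_derivative f (at x) = frechet_derivative g (at x)"
  unfolding frechet_derivative_def
  using has_derivative_transform_within_open[OF _ assms(1,2)] assms(3) by metis

lemma Ck_on_cong: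
  assumes "open S" and "\<And>x. x \<in> S \<Longrightarrow> f x = g x"
  shows "Ck_on n S f \<longleftrightarrow> Ck_on n S g"
  using assms(2)
proof (induction n arbitrary: f g)
  case 0
  then show ?case by (simp cong: continuous_on_cong)
next
  case (Suc n)
  have diff: "f differentiable (at x) \<longleftrightarrow> g differentiable (at x)" if "x \<in> S" for x
    unfolding differentiable_def
    using has_derivative_transform_within_open[OF _ assms(1) that] Suc.prems by metis
  have deriv: "frechet_derivative f (at x) = frechet_derivative g (at x)" if "x \<in> S" for x
    using frechet_derivative_cong_open[OF assms(1) that] Suc.prems by blast
  have "Ck_on n S (\<lambda>x. frechet_derivative f (at x) v) \<longleftrightarrow> Ck_on n S (\<lambda>x. frechet_derivative g (at x) v)" for v
    by (rule Suc.IH) (simp add: deriv)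
  with diff show ?case by auto
qed

lemma Ck_on_subset: "Ck_on n S f \<Longrightarrow> T \<subseteq> S \<Longrightarrow> Ck_on n T f"
  by (induction n arbitrary: f) (auto intro: continuous_on_subset)

text \<open>\<open>frechet_derivative\<close> is a choice operator, so the definition of
  \<open>Ck_on\<close> is awkward to verify directly. An explicit derivative on the open set
  \<open>S\<close> identifies it by uniqueness, and regularity is then checked on the
  formula.\<close>

lemma Ck_on_SucI:
  assumes "open S" "\<And>x. x \<in> S \<Longrightarrow> (f has_derivative f' x) (at x)"
    and "\<And>v. Ck_on n S (\<lambda>x. f' x v)"
  shows "Ck_on (Suc n) S f"
proof -
  have "frechet_derivative f (at x) = f' x" if "x \<in> S" for x
    using frechet_derivative_at[OF assms(2)[OF that]] by simp
  then have "Ck_on n S (\<lambda>x. frechet_derivative f (at x) v)" for v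
    using Ck_on_cong[OF assms(1), of "\<lambda>x. frechet_derivative f (at x) v" "\<lambda>x. f' x v"]
      assms(3) by simp
  with assms(2) show ?thesis by (auto simp: differentiable_def)
qed

lemma Ck_on_Suc_has_derivative:
  "Ck_on (Suc n) S f \<Longrightarrow> x \<in> S \<Longrightarrow> (f has_derivative frechet_derivative f (at x)) (at x)"
  by (simp add: frechet_derivative_works)

lemma Ck_on_SucD: "Ck_on (Suc n) S f \<Longrightarrow> Ck_on n S f"
proof (induction n arbitrary: f)
  case 0
  then show ?case
    by (auto intro!: continuous_at_imp_continuous_on differentiable_imp_continuous_within)
qed auto

lemma Ck_on_imp_continuous_on: "Ck_on n S f \<Longrightarrow> continuous_on S f"
proof (induction n)
  case (Suc n)
  then show ?case using Ck_on_SucD by blast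
qed simp

lemma Ck_on_const: "open S \<Longrightarrow> Ck_on n S (\<lambda>x. c)"
  by (induction n arbitrary: c) auto

lemma Ck_on_compose_bounded_linear:
  assumes "bounded_linear L" "open S" "Ck_on n S f"
  shows "Ck_on n S (\<lambda>x. L (f x))"
  using assms(3)
proof (induction n arbitrary: f)
  case 0
  then show ?case
    using bounded_linear.continuous_on[OF assms(1)] by simp
next
  case (Suc n)
  show ?case
  proof (rule Ck_on_SucI[OF assms(2)])
    show "((\<lambda>x. L (f x)) has_derivative (\<lambda>v. L (frechet_derivative f (at x) v))) (at x)" if "x \<in> S" for x
      using bounded_linear.has_derivative[OF assms(1) Ck_on_Suc_has_derivative[OF Suc.prems that]] .
    show "Ck_on n S (\<lambda>x. L (frechet_derivative f (at x) v))" for v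
      using Suc.prems by (intro Suc.IH) simp
  qed
qed

lemma Ck_on_add:
  assumes "open S" "Ck_on n S f" "Ck_on n S g"
  shows "Ck_on n S (\<lambda>x. f x + g x)"
  using assms(2,3)
proof (induction n arbitrary: f g)
  case (Suc n)
  show ?case
    by (rule Ck_on_SucI[OF assms(1)
          has_derivative_add[OF Suc.prems(1,2)[THEN Ck_on_Suc_has_derivative]]])
      (use Suc.prems in \<open>auto intro: Suc.IH\<close>)
qed (auto intro: continuous_on_add)

lemma Ck_on_bilinear:
  assumes "bounded_bilinear pr" "open S" "Ck_on n S f" "Ck_on n S g"
  shows "Ck_on n S (\<lambda>x. pr (f x) (g x))"
  using assms(3,4)
proof (induction n arbitrary: f g)
  case (Suc n)
  show ?case
  proof (rule Ck_on_SucI[OF assms(2) bounded_bilinear.FDERIV[OF assms(1)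
          Suc.prems(1,2)[THEN Ck_on_Suc_has_derivative]]])
    show "Ck_on n S (\<lambda>x. pr (f x) (frechet_derivative g (at x) v) + pr (frechet_derivative f (at x) v) (g x))" for v
      using Suc.prems Suc.prems[THEN Ck_on_SucD] by (intro Ck_on_add[OF assms(2)] Suc.IH) auto
  qed
qed (use bounded_bilinear.continuous_on[OF assms(1)] in auto)

lemma Ck_on_Pair:
  assumes "open S" "Ck_on n S f" "Ck_on n S g"
  shows "Ck_on n S (\<lambda>x. (f x, g x))"
proof -
  have "bounded_linear (\<lambda>x::'b. (x, 0::'c))" "bounded_linear (\<lambda>x::'c. (0::'b, x))"
    by (auto intro: bounded_linear_Pair bounded_linear_ident bounded_linear_zero)
  from this[THEN Ck_on_compose_bounded_linear] assms
  have "Ck_on n S (\<lambda>x. (f x, 0) + (0, g x))" by (intro Ck_on_add) auto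
  then show ?thesis by simp
qed

lemma Ck_on_sum:
  assumes "open S" "\<And>i. i \<in> I \<Longrightarrow> Ck_on n S (f i)"
  shows "Ck_on n S (\<lambda>x. \<Sum>i\<in>I. f i x)"
  using assms(2)
  by (induction I rule: infinite_finite_induct) (auto simp: Ck_on_const Ck_on_add assms(1))

lemma linear_basis_expansion:
  fixes L :: "'a::euclidean_space \<Rightarrow> 'b::real_vector"
  assumes "linear L"
  shows "L w = (\<Sum>b\<in>Basis. (w \<bullet> b) *\<^sub>R L b)"
proof -
  have "L w = L (\<Sum>b\<in>Basis. (w \<bullet> b) *\<^sub>R b)" by (simp add: euclidean_representation)
  also have "\<dots> = (\<Sum>b\<in>Basis. (w \<bullet> b) *\<^sub>R L b)"
    by (simp add: linear_sum[OF assms] linear_cmul[OF assms])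
  finally show ?thesis .
qed

text \<open>The chain rule composes linear maps that vary with the point, which the induction cannot
  use directly. Expanding over \<open>Basis\<close> gives a finite sum of scalar functions times
  directional derivatives of \<open>g\<close> along \<open>f\<close>, to which the product rule and
  the induction hypothesis, generalised over \<open>g\<close>, apply.\<close>

lemma Ck_on_compose:
  fixes f :: "'a::real_normed_vector \<Rightarrow> 'b::euclidean_space" and g :: "'b \<Rightarrow> 'c::real_normed_vector"
  assumes "open S" "open T" "f ` S \<subseteq> T" "Ck_on n S f" "Ck_on n T g"
  shows "Ck_on n S (\<lambda>x. g (f x))"
  using assms(4,5)
proof (induction n arbitrary: g)
  case 0
  then show ?case using assms(3) by (auto intro: continuous_on_compose2)
next
  case (Suc n)
  have Df: "(f has_derivative frechet_derivative f (at x)) (at x)" if "x \<in> S" for x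
    using Ck_on_Suc_has_derivative[OF Suc.prems(1) that] .
  have Dg: "(g has_derivative frechet_derivative g (at y)) (at y)" if "y \<in> T" for y
    using Ck_on_Suc_has_derivative[OF Suc.prems(2) that] .
  show ?case
  proof (rule Ck_on_SucI[OF assms(1)])
    fix x assume x: "x \<in> S"
    then have "f x \<in> T" using assms(3) by auto
    have "(g \<circ> f has_derivative frechet_derivative g (at (f x)) \<circ> frechet_derivative f (at x)) (at x)"
      by (rule diff_chain_at[OF Df[OF x] Dg[OF \<open>f x \<in> T\<close>]])
    moreover have "frechet_derivative g (at (f x)) \<circ> frechet_derivative f (at x)
      = (\<lambda>v. \<Sum>b\<in>Basis. (frechet_derivative f (at x) v \<bullet> b) *\<^sub>R frechet_derivative g (at (f x)) b)"
      unfolding o_def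
      by (rule ext, rule linear_basis_expansion[OF has_derivative_linear[OF Dg[OF \<open>f x \<in> T\<close>]]])
    ultimately show "((\<lambda>x. g (f x)) has_derivative
        (\<lambda>v. \<Sum>b\<in>Basis. (frechet_derivative f (at x) v \<bullet> b) *\<^sub>R frechet_derivative g (at (f x)) b)) (at x)"
      by (simp add: o_def)
  next
    show "Ck_on n S (\<lambda>x. \<Sum>b\<in>Basis. (frechet_derivative f (at x) v \<bullet> b) *\<^sub>R frechet_derivative g (at (f x)) b)" for v
    proof (intro Ck_on_sum Ck_on_bilinear[OF bounded_bilinear_scaleR] assms(1))
      show "Ck_on n S (\<lambda>x. frechet_derivative f (at x) v \<bullet> b)" for b
        using Suc.prems(1) by (intro Ck_on_compose_bounded_linear[OF bounded_linear_inner_left] assms(1)) simp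
      show "Ck_on n S (\<lambda>x. frechet_derivative g (at (f x)) b)" for b
        by (rule Suc.IH[of "\<lambda>y. frechet_derivative g (at y) b"])
          (use Suc.prems Suc.prems(1)[THEN Ck_on_SucD] in auto)
    qed
  qed
qed

text \<open>Bootstrapping: the derivative of \<open>h\<close> is as regular as \<open>h\<close> itself.\<close>

lemma Ck_on_autonomous:
  fixes h :: "'a::real_normed_vector \<Rightarrow> 'b::euclidean_space"
  assumes "open S" "open T" "h ` S \<subseteq> T"
    and "\<And>x. x \<in> S \<Longrightarrow> (h has_derivative (\<lambda>v. K v (h x))) (at x)"
    and "\<And>v n. Ck_on n T (K v)"
  shows "Ck_on n S h"
proof (induction n)
  case 0
  then show ?case
    using assms(4) by (auto intro!: has_derivative_continuous_on intro: has_derivative_at_withinI)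
next
  case (Suc n)
  show ?case
    using Ck_on_compose[OF assms(1-3) Suc assms(5)]
    by (intro Ck_on_SucI[OF assms(1,4)]) auto
qed

section \<open>Closure properties of smooth maps\<close>

lemma smooth_on_cong:
  "open S \<Longrightarrow> (\<And>x. x \<in> S \<Longrightarrow> f x = g x) \<Longrightarrow> smooth_on S f \<longleftrightarrow> smooth_on S g"
  unfolding smooth_on_def using Ck_on_cong by blast

lemma smooth_on_subset: "smooth_on S f \<Longrightarrow> T \<subseteq> S \<Longrightarrow> smooth_on T f"
  unfolding smooth_on_def using Ck_on_subset by blast

lemma smooth_on_has_derivative:
  "smooth_on S f \<Longrightarrow> x \<in> S \<Longrightarrow> (f has_derivative frechet_derivative f (at x)) (at x)"
  unfolding smooth_on_def using Ck_on_Suc_has_derivative by blast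

lemma smooth_on_frechet_derivative:
  "smooth_on S f \<Longrightarrow> smooth_on S (\<lambda>x. frechet_derivative f (at x) v)"
  unfolding smooth_on_def using Ck_on.simps(2) by blast

lemma smooth_onI:
  assumes "open S" "\<And>x. x \<in> S \<Longrightarrow> (f has_derivative f' x) (at x)"
    and "\<And>v. smooth_on S (\<lambda>x. f' x v)"
  shows "smooth_on S f"
  unfolding smooth_on_def
proof
  fix n
  have "Ck_on (Suc n) S f"
    using assms(3) by (intro Ck_on_SucI[OF assms(1,2)]) (auto simp: smooth_on_def)
  then show "Ck_on n S f" by (rule Ck_on_SucD)
qed

lemma smooth_on_imp_continuous_on: "smooth_on S f \<Longrightarrow> continuous_on S f"
  unfolding smooth_on_def using Ck_on.simps(1) by blast

lemma smooth_on_const [simp]: "open S \<Longrightarrow> smooth_on S (\<lambda>x. c)"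
  by (simp add: smooth_on_def Ck_on_const)

lemma smooth_on_compose_bounded_linear:
  "bounded_linear L \<Longrightarrow> open S \<Longrightarrow> smooth_on S f \<Longrightarrow> smooth_on S (\<lambda>x. L (f x))"
  by (simp add: smooth_on_def Ck_on_compose_bounded_linear)

lemma smooth_on_bounded_linear: "bounded_linear L \<Longrightarrow> open S \<Longrightarrow> smooth_on S L"
  by (rule smooth_onI[of _ _ "\<lambda>_. L"]) (auto intro: bounded_linear_imp_has_derivative)

lemma smooth_on_add:
  "open S \<Longrightarrow> smooth_on S f \<Longrightarrow> smooth_on S g \<Longrightarrow> smooth_on S (\<lambda>x. f x + g x)"
  by (simp add: smooth_on_def Ck_on_add)

lemma smooth_on_bilinear:
  "bounded_bilinear pr \<Longrightarrow> open S \<Longrightarrow> smooth_on S f \<Longrightarrow> smooth_on S g \<Longrightarrow> smooth_on S (\<lambda>x. pr (f x) (g x))"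
  by (simp add: smooth_on_def Ck_on_bilinear)

lemmas smooth_on_mult = smooth_on_bilinear[OF bounded_bilinear_mult]
lemmas smooth_on_fst = smooth_on_compose_bounded_linear[OF bounded_linear_fst]
lemmas smooth_on_snd = smooth_on_compose_bounded_linear[OF bounded_linear_snd]
lemmas smooth_on_minus = smooth_on_compose_bounded_linear[OF bounded_linear_minus[OF bounded_linear_ident]]

lemma smooth_on_diff:
  "open S \<Longrightarrow> smooth_on S f \<Longrightarrow> smooth_on S g \<Longrightarrow> smooth_on S (\<lambda>x. f x - g x)"
  using smooth_on_add[OF _ _ smooth_on_minus, of S f g] by simp

lemma smooth_on_Pair:
  "open S \<Longrightarrow> smooth_on S f \<Longrightarrow> smooth_on S g \<Longrightarrow> smooth_on S (\<lambda>x. (f x, g x))"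
  by (simp add: smooth_on_def Ck_on_Pair)

lemma smooth_on_compose:
  fixes f :: "'a::real_normed_vector \<Rightarrow> 'b::euclidean_space" and g :: "'b \<Rightarrow> 'c::real_normed_vector"
  shows "open S \<Longrightarrow> open T \<Longrightarrow> f ` S \<subseteq> T \<Longrightarrow> smooth_on S f \<Longrightarrow> smooth_on T g \<Longrightarrow> smooth_on S (\<lambda>x. g (f x))"
  unfolding smooth_on_def using Ck_on_compose by blast

lemma smooth_on_autonomous:
  fixes h :: "'a::real_normed_vector \<Rightarrow> 'b::euclidean_space"
  assumes "open S" "open T" "h ` S \<subseteq> T"
    and "\<And>x. x \<in> S \<Longrightarrow> (h has_derivative (\<lambda>v. K v (h x))) (at x)"
    and "\<And>v. smooth_on T (K v)"
  shows "smooth_on S h"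
  using Ck_on_autonomous[OF assms(1-4)] assms(5) unfolding smooth_on_def by blast

lemma smooth_on_ident: "open S \<Longrightarrow> smooth_on S (\<lambda>x. x)"
  by (rule smooth_on_bounded_linear[OF bounded_linear_ident])

text \<open>The derivative of the reciprocal is the polynomial \<open>- (y * v * y)\<close> in the
  reciprocal \<open>y\<close> itself, so \<open>smooth_on_autonomous\<close> replaces an induction
  over higher derivatives.\<close>

lemma smooth_on_inverse:
  fixes f :: "'a::real_normed_vector \<Rightarrow> real"
  assumes "open S" "smooth_on S f" "\<And>x. x \<in> S \<Longrightarrow> f x \<noteq> 0"
  shows "smooth_on S (\<lambda>x. inverse (f x))"
proof -
  have o: "open (- {0::real})" by auto
  have "smooth_on (- {0::real}) inverse"
    by (rule smooth_on_autonomous[OF o open_UNIV, of _ "\<lambda>v y. - (y * v * y)"])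
      (auto intro!: smooth_on_minus smooth_on_mult smooth_on_ident has_derivative_inverse')
  moreover have "f ` S \<subseteq> - {0}" using assms(3) by auto
  ultimately show ?thesis using smooth_on_compose[OF assms(1) o _ assms(2)] by blast
qed

lemma smooth_on_divide:
  fixes f :: "'a::real_normed_vector \<Rightarrow> real"
  assumes "open S" "smooth_on S f" "smooth_on S g" "\<And>x. x \<in> S \<Longrightarrow> g x \<noteq> 0"
  shows "smooth_on S (\<lambda>x. f x / g x)"
  using smooth_on_mult[OF assms(1,2) smooth_on_inverse[OF assms(1,3,4)]] by (simp add: divide_inverse)

text \<open>As for the reciprocal: in terms of \<open>y = sqrt x\<close> the derivative is
  \<open>inverse y / 2 * v\<close>, which is smooth on the half line that contains
  \<open>y\<close>.\<close>

lemma smooth_on_sqrt: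
  assumes "open S" "smooth_on S f" "\<And>x. x \<in> S \<Longrightarrow> f x > 0"
  shows "smooth_on S (\<lambda>x. sqrt (f x))"
proof -
  have o: "open {0::real<..}" by auto
  have "smooth_on {0::real<..} sqrt"
  proof (rule smooth_on_autonomous[OF o o, of _ "\<lambda>v y. inverse y / 2 * v"])
    show "(sqrt has_derivative (\<lambda>v. inverse (sqrt x) / 2 * v)) (at x)" if "x \<in> {0<..}" for x
      using DERIV_real_sqrt[of x] that by (simp only: has_field_derivative_def greaterThan_iff)
    show "smooth_on {0<..} (\<lambda>y::real. inverse y / 2 * v)" for v
      by (intro smooth_on_mult smooth_on_divide smooth_on_inverse smooth_on_ident smooth_on_const o) auto
  qed auto
  moreover have "f ` S \<subseteq> {0<..}" using assms(3) by auto
  ultimately show ?thesis using smooth_on_compose[OF assms(1) o _ assms(2)] by blast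
qed

text \<open>Stated for each finite order because \<open>smooth_flow\<close> uses it inside an
  induction on the order.\<close>

lemma Ck_on_exp:
  assumes "open S" "Ck_on n S f"
  shows "Ck_on n S (\<lambda>x. exp (f x :: real))"
proof -
  have "Ck_on n UNIV (exp :: real \<Rightarrow> real)"
    by (rule Ck_on_autonomous[OF open_UNIV open_UNIV, of _ "\<lambda>v y. y * v"])
     (auto simp: has_field_derivative_def[symmetric]
       intro!: Ck_on_bilinear[OF bounded_bilinear_mult] Ck_on_const
        smooth_on_ident[unfolded smooth_on_def, rule_format])
  from Ck_on_compose[OF assms(1) open_UNIV _ assms(2) this] show ?thesis by auto
qed


section \<open>Diffeomorphisms of plane domains\<close>

lemma linear_prod_real:
  fixes L :: "real \<times> real \<Rightarrow> 'b::real_vector"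
  assumes "linear L"
  shows "L v = fst v *\<^sub>R L (1, 0) + snd v *\<^sub>R L (0, 1)"
proof -
  have "v = fst v *\<^sub>R (1, 0) + snd v *\<^sub>R (0, 1)" by (simp add: prod_eq_iff)
  then show ?thesis using linear_add[OF assms] linear_cmul[OF assms] by metis
qed

text \<open>The derivative of the inverse at \<open>w\<close> is the inverse Jacobian matrix taken
  at \<open>inv_into V \<Psi> w\<close>. This is an autonomous equation with smooth right-hand side,
  so the first derivative of the inverse yields all higher ones.\<close>

lemma smooth_on_inv_into:
  fixes \<Psi> :: "real \<times> real \<Rightarrow> real \<times> real"
  assumes V: "open V" and W: "open (\<Psi> ` V)" and smooth: "smooth_on V \<Psi>" and inj: "inj_on \<Psi> V"
    and det: "\<And>z. z \<in> V \<Longrightarrow> det2 (frechet_derivative \<Psi> (at z)) \<noteq> 0"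
  shows "smooth_on (\<Psi> ` V) (inv_into V \<Psi>)"
proof -
  define a b where "a z = frechet_derivative \<Psi> (at z) (1, 0)" and "b z = frechet_derivative \<Psi> (at z) (0, 1)" for z
  define d where "d z = det2 (frechet_derivative \<Psi> (at z))" for z
  \<comment> \<open>The inverse of the Jacobian matrix with columns \<open>a z\<close> and \<open>b z\<close>, by Cramer's rule.\<close>
  define K where "K w z = ((snd (b z) * fst w - fst (b z) * snd w) / d z,
      (fst (a z) * snd w - snd (a z) * fst w) / d z)" for w z
  have d: "d z = fst (a z) * snd (b z) - fst (b z) * snd (a z)" for z
    by (simp add: d_def det2_def a_def b_def)
  have d0: "d z \<noteq> 0" if "z \<in> V" for z
    using det[OF that] by (simp add: d_def)
  have sa: "smooth_on V a" and sb: "smooth_on V b"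
    using smooth_on_frechet_derivative[OF smooth] unfolding a_def b_def by auto
  have smooth_d: "smooth_on V d"
    unfolding d by (intro smooth_on_diff smooth_on_mult smooth_on_fst smooth_on_snd V sa sb)
  have smooth_K: "smooth_on V (K w)" for w
    unfolding K_def
    by (intro smooth_on_Pair smooth_on_divide smooth_on_diff smooth_on_mult smooth_on_fst
        smooth_on_snd smooth_on_const V sa sb smooth_d d0)
  have DK: "frechet_derivative \<Psi> (at z) \<circ> (\<lambda>w. K w z) = id" if z: "z \<in> V" for z
  proof
    fix w
    have "frechet_derivative \<Psi> (at z) (K w z) = fst (K w z) *\<^sub>R a z + snd (K w z) *\<^sub>R b z"
      unfolding a_def b_def
      by (rule linear_prod_real[OF has_derivative_linear[OF smooth_on_has_derivative[OF smooth z]]])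
    also have "\<dots> = w"
      using d0[OF z] unfolding K_def prod_eq_iff
      by (simp add: divide_simps) (simp add: d algebra_simps)
    finally show "(frechet_derivative \<Psi> (at z) \<circ> (\<lambda>w. K w z)) w = id w" by simp
  qed
  show ?thesis
  proof (rule smooth_on_autonomous[OF W V, of _ K])
    show "inv_into V \<Psi> ` \<Psi> ` V \<subseteq> V" using inj by auto
    show "smooth_on V (K w)" for w by (rule smooth_K)
    fix w assume "w \<in> \<Psi> ` V"
    then obtain z where z: "z \<in> V" "w = \<Psi> z" by auto
    have "(inv_into V \<Psi> has_derivative (\<lambda>w. K w z)) (at (\<Psi> z))"
      by (rule has_derivative_inverse_strong[OF V z(1) smooth_on_imp_continuous_on[OF smooth] _
            smooth_on_has_derivative[OF smooth z(1)] DK[OF z(1)]])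
        (simp add: inj)
    then show "(inv_into V \<Psi> has_derivative (\<lambda>v. K v (inv_into V \<Psi> w))) (at w)"
      using z inj by simp
  qed
qed

text \<open>Openness of the image comes from invariance of domain.\<close>

lemma diffeomorphism_if_det2_nonzero:
  fixes \<Psi> :: "real \<times> real \<Rightarrow> real \<times> real"
  assumes "open V" "smooth_on V \<Psi>" "inj_on \<Psi> V"
    and "\<And>z. z \<in> V \<Longrightarrow> det2 (frechet_derivative \<Psi> (at z)) \<noteq> 0"
  shows "diffeomorphism V (\<Psi> ` V) \<Psi>"
proof -
  have W: "open (\<Psi> ` V)"
    using invariance_of_domain[OF smooth_on_imp_continuous_on[OF assms(2)] assms(1,3)] .
  show ?thesis
    unfolding diffeomorphism_def bij_betw_def
    using assms smooth_on_inv_into[OF assms(1) W assms(2-4)] W by blast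
qed

lemma diffeomorphism_inverse_derivative:
  assumes "diffeomorphism V W \<Psi>" "z \<in> V"
  shows "frechet_derivative (inv_into V \<Psi>) (at (\<Psi> z)) (frechet_derivative \<Psi> (at z) v) = v"
    and "frechet_derivative \<Psi> (at z) (frechet_derivative (inv_into V \<Psi>) (at (\<Psi> z)) w) = w"
proof -
  have V: "open V" and W: "open W" and bij: "bij_betw \<Psi> V W"
    and s: "smooth_on V \<Psi>" "smooth_on W (inv_into V \<Psi>)"
    using assms(1) by (auto simp: diffeomorphism_def)
  have inj: "inj_on \<Psi> V" and im: "\<Psi> ` V = W" using bij by (auto simp: bij_betw_def)
  have wz: "\<Psi> z \<in> W" using im assms(2) by auto
  have inv: "inv_into V \<Psi> (\<Psi> z) = z" using inj assms(2) by simp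
  have D: "(\<Psi> has_derivative frechet_derivative \<Psi> (at z)) (at z)"
    using smooth_on_has_derivative[OF s(1) assms(2)] .
  have I: "(inv_into V \<Psi> has_derivative frechet_derivative (inv_into V \<Psi>) (at (\<Psi> z))) (at (\<Psi> z))"
    using smooth_on_has_derivative[OF s(2) wz] .
  have "(inv_into V \<Psi> \<circ> \<Psi> has_derivative
      frechet_derivative (inv_into V \<Psi>) (at (\<Psi> z)) \<circ> frechet_derivative \<Psi> (at z)) (at z)"
    by (rule diff_chain_at[OF D I])
  moreover have "(inv_into V \<Psi> \<circ> \<Psi> has_derivative (\<lambda>v. v)) (at z)"
    by (rule has_derivative_transform_within_open[OF has_derivative_ident V assms(2)]) (simp add: inj)
  ultimately have "frechet_derivative (inv_into V \<Psi>) (at (\<Psi> z)) \<circ> frechet_derivative \<Psi> (at z) = (\<lambda>v. v)"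
    by (rule has_derivative_unique)
  then show "frechet_derivative (inv_into V \<Psi>) (at (\<Psi> z)) (frechet_derivative \<Psi> (at z) v) = v"
    by (simp add: fun_eq_iff)
  have "(\<Psi> \<circ> inv_into V \<Psi> has_derivative
      frechet_derivative \<Psi> (at z) \<circ> frechet_derivative (inv_into V \<Psi>) (at (\<Psi> z))) (at (\<Psi> z))"
    by (rule diff_chain_at[OF I]) (simp add: inv D)
  moreover have "(\<Psi> \<circ> inv_into V \<Psi> has_derivative (\<lambda>v. v)) (at (\<Psi> z))"
    by (rule has_derivative_transform_within_open[OF has_derivative_ident W wz])
      (auto simp: f_inv_into_f im[symmetric])
  ultimately have "frechet_derivative \<Psi> (at z) \<circ> frechet_derivative (inv_into V \<Psi>) (at (\<Psi> z)) = (\<lambda>v. v)"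
    by (rule has_derivative_unique)
  then show "frechet_derivative \<Psi> (at z) (frechet_derivative (inv_into V \<Psi>) (at (\<Psi> z)) w) = w"
    by (simp add: fun_eq_iff)
qed

lemma det2_compose:
  assumes "linear K" "linear L"
  shows "det2 (\<lambda>v. K (L v)) = det2 K * det2 L"
  unfolding det2_def
  using linear_prod_real[OF assms(1), of "L (1, 0)"] linear_prod_real[OF assms(1), of "L (0, 1)"]
  by (simp add: algebra_simps)

lemma det2_ident [simp]: "det2 (\<lambda>v. v) = 1"
  by (simp add: det2_def)

lemma diffeomorphism_det2_nonzero:
  assumes "diffeomorphism V W \<Psi>" "z \<in> V"
  shows "det2 (frechet_derivative \<Psi> (at z)) \<noteq> 0"
proof -
  have "\<Psi> z \<in> W" using assms by (auto simp: diffeomorphism_def bij_betw_def)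
  then have "linear (frechet_derivative \<Psi> (at z))"
    "linear (frechet_derivative (inv_into V \<Psi>) (at (\<Psi> z)))"
    using assms smooth_on_has_derivative has_derivative_linear by (metis diffeomorphism_def)+
  from det2_compose[OF this(2,1)] show ?thesis
    by (auto simp: diffeomorphism_inverse_derivative[OF assms])
qed

lemma diffeomorphism_restrict:
  fixes \<Psi> :: "real \<times> real \<Rightarrow> real \<times> real"
  assumes "diffeomorphism V W \<Psi>" "open V'" "V' \<subseteq> V"
  shows "diffeomorphism V' (\<Psi> ` V') \<Psi>"
proof (rule diffeomorphism_if_det2_nonzero[OF assms(2)])
  show "smooth_on V' \<Psi>" "inj_on \<Psi> V'"
    using assms smooth_on_subset[OF _ assms(3)] inj_on_subset[OF _ assms(3)]
    by (auto simp: diffeomorphism_def bij_betw_def)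
  show "det2 (frechet_derivative \<Psi> (at z)) \<noteq> 0" if "z \<in> V'" for z
    using diffeomorphism_det2_nonzero[OF assms(1)] that assms(3) by blast
qed

lemma frechet_derivative_compose_smooth:
  assumes "smooth_on V \<Phi>" "smooth_on W \<Psi>" "z \<in> V" "\<Phi> z \<in> W"
  shows "frechet_derivative (\<lambda>z. \<Psi> (\<Phi> z)) (at z) v
    = frechet_derivative \<Psi> (at (\<Phi> z)) (frechet_derivative \<Phi> (at z) v)"
proof -
  have "(\<Psi> \<circ> \<Phi> has_derivative frechet_derivative \<Psi> (at (\<Phi> z)) \<circ> frechet_derivative \<Phi> (at z)) (at z)"
    by (rule diff_chain_at[OF smooth_on_has_derivative[OF assms(1,3)] smooth_on_has_derivative[OF assms(2,4)]])
  from frechet_derivative_at[OF this] show ?thesis by (simp add: o_def fun_eq_iff)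
qed

lemma diffeomorphism_compose:
  fixes \<Phi> \<Psi> :: "real \<times> real \<Rightarrow> real \<times> real"
  assumes "diffeomorphism U V \<Phi>" "diffeomorphism V' W \<Psi>" "V \<subseteq> V'"
  shows "diffeomorphism U (\<Psi> ` V) (\<lambda>z. \<Psi> (\<Phi> z))"
proof -
  have im: "\<Phi> ` U = V" and UV: "open U" "open V'" and s: "smooth_on U \<Phi>" "smooth_on V' \<Psi>"
    and inj: "inj_on \<Phi> U" "inj_on \<Psi> V'"
    using assms by (auto simp: diffeomorphism_def bij_betw_def)
  have "diffeomorphism U ((\<lambda>z. \<Psi> (\<Phi> z)) ` U) (\<lambda>z. \<Psi> (\<Phi> z))"
  proof (rule diffeomorphism_if_det2_nonzero[OF UV(1)])
    show "smooth_on U (\<lambda>z. \<Psi> (\<Phi> z))"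
      using smooth_on_compose[OF UV _ s] im assms(3) by simp
    show "inj_on (\<lambda>z. \<Psi> (\<Phi> z)) U"
      using comp_inj_on[OF inj(1) inj_on_subset[OF inj(2)]] im assms(3) by (simp add: o_def)
    fix z assume z: "z \<in> U"
    then have \<Phi>z: "\<Phi> z \<in> V'" using im assms(3) by auto
    have "frechet_derivative (\<lambda>z. \<Psi> (\<Phi> z)) (at z)
      = (\<lambda>v. frechet_derivative \<Psi> (at (\<Phi> z)) (frechet_derivative \<Phi> (at z) v))"
      using frechet_derivative_compose_smooth[OF s z \<Phi>z] by auto
    then have "det2 (frechet_derivative (\<lambda>z. \<Psi> (\<Phi> z)) (at z))
      = det2 (frechet_derivative \<Psi> (at (\<Phi> z))) * det2 (frechet_derivative \<Phi> (at z))"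
      using det2_compose[OF has_derivative_linear[OF smooth_on_has_derivative[OF s(2) \<Phi>z]]
          has_derivative_linear[OF smooth_on_has_derivative[OF s(1) z]]] by simp
    then show "det2 (frechet_derivative (\<lambda>z. \<Psi> (\<Phi> z)) (at z)) \<noteq> 0"
      using diffeomorphism_det2_nonzero[OF assms(1) z] diffeomorphism_det2_nonzero[OF assms(2) \<Phi>z] by simp
  qed
  moreover have "(\<lambda>z. \<Psi> (\<Phi> z)) ` U = \<Psi> ` V" using im by auto
  ultimately show ?thesis by simp
qed


section \<open>A scalar ordinary differential equation\<close>

text \<open>This is the integral of \<open>h\<close> from \<open>0\<close> to \<open>x\<close>,
  rescaled to a fixed interval. Negative \<open>x\<close> needs no sign convention, and
  \<open>x\<close> becomes a parameter of the integrand like any other.\<close>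

definition primitive :: "(real \<Rightarrow> real) \<Rightarrow> real \<Rightarrow> real" where
  "primitive h x = x * integral {0..1} (\<lambda>\<theta>. h (x * \<theta>))"

lemma primitive_0 [simp]: "primitive h 0 = 0"
  by (simp add: primitive_def)

lemma abs_mult_unit_interval_less:
  fixes x b \<theta> :: real
  assumes "\<bar>x\<bar> < b" "\<theta> \<in> {0..1}"
  shows "\<bar>x * \<theta>\<bar> < b"
proof -
  have "\<bar>x\<bar> * \<theta> \<le> \<bar>x\<bar>" using assms(2) by (intro mult_left_le) auto
  then show ?thesis using assms by (simp add: abs_mult)
qed

text \<open>\<open>H\<close>, the integral from the fixed point \<open>-c\<close>, is differentiable
  by the fundamental theorem; differentiating \<open>H (u * \<theta>)\<close> in
  \<open>\<theta>\<close> identifies \<open>H u - H 0\<close> with the rescaled integral. The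
  auxiliary \<open>c\<close> below \<open>b\<close> gives a compact interval inside the open one on
  which \<open>h\<close> is continuous.\<close>

lemma primitive_has_derivative:
  assumes "continuous_on {-b<..<b} h" "\<bar>x\<bar> < b"
  shows "(primitive h has_real_derivative h x) (at x)"
proof -
  obtain c where c: "\<bar>x\<bar> < c" "c < b" using dense[OF assms(2)] by auto
  have cont: "continuous_on {-c..c} h"
    by (rule continuous_on_subset[OF assms(1)]) (use c in auto)
  define H where "H u = integral {-c..u} h" for u
  have H: "(H has_real_derivative h u) (at u)" if "\<bar>u\<bar> < c" for u
  proof -
    have "-c < u" "u < c" using that by auto
    then show ?thesis
      using integral_has_real_derivative[OF cont, of u] at_within_Icc_at[of "-c" u c]
      unfolding H_def by simp
  qed
  have prim: "H u - H 0 = primitive h u" if u: "\<bar>u\<bar> < c" for u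
  proof -
    have cv: "continuous_on {0..1} (\<lambda>\<theta>. h (u * \<theta>))"
      by (rule continuous_on_compose2[OF cont])
        (auto intro!: continuous_intros dest!: abs_mult_unit_interval_less[OF u])
    have "((\<lambda>\<theta>. u * h (u * \<theta>)) has_integral (H (u * 1) - H (u * 0))) {0..1}"
    proof (rule fundamental_theorem_of_calculus)
      fix \<theta> :: real assume \<theta>: "\<theta> \<in> {0..1}"
      have "((\<lambda>\<theta>. H (u * \<theta>)) has_real_derivative h (u * \<theta>) * u) (at \<theta>)"
        by (rule DERIV_chain2[where f=H and g="\<lambda>\<theta>. u * \<theta>", OF H[OF abs_mult_unit_interval_less[OF u \<theta>]]])
          (auto intro!: derivative_eq_intros)
      then show "((\<lambda>\<theta>. H (u * \<theta>)) has_vector_derivative u * h (u * \<theta>)) (at \<theta> within {0..1})"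
        by (simp add: has_real_derivative_iff_has_vector_derivative mult.commute
            has_vector_derivative_at_within)
    qed simp
    from integral_unique[OF this] show ?thesis by (simp add: primitive_def)
  qed
  have "((\<lambda>u. H u - H 0) has_real_derivative h x) (at x)"
    using DERIV_diff[OF H[OF c(1)] DERIV_const[of "H 0"]] by simp
  then have "(primitive h has_real_derivative h x) (at x within UNIV)"
  proof (rule has_field_derivative_transform_within[where d="c - \<bar>x\<bar>"])
    fix u assume "dist u x < c - \<bar>x\<bar>"
    then have "\<bar>u\<bar> < c" unfolding dist_real_def by arith
    then show "H u - H 0 = primitive h u" by (rule prim)
  qed (use c in auto)
  then show ?thesis by simp
qed

text \<open>Only the second partial derivative has to be continuous, jointly in both variables. In
  the applications the first one is read off from an integrand or from the differential equation,
  and the second one is a primitive or its exponential.\<close>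

lemma has_derivative_continuous_partials:
  fixes f :: "real \<times> real \<Rightarrow> real"
  assumes I: "open I" "open J" "convex J"
    and fx: "\<And>x y. x \<in> I \<Longrightarrow> y \<in> J \<Longrightarrow> ((\<lambda>x. f (x, y)) has_real_derivative f1 (x, y)) (at x)"
    and fy: "\<And>x y. x \<in> I \<Longrightarrow> y \<in> J \<Longrightarrow> ((\<lambda>y. f (x, y)) has_real_derivative f2 (x, y)) (at y)"
    and cont: "continuous_on (I \<times> J) f2"
    and z: "z \<in> I \<times> J"
  shows "(f has_derivative (\<lambda>v. fst v * f1 z + snd v * f2 z)) (at z)"
proof -
  obtain x y where z': "z = (x, y)" "x \<in> I" "y \<in> J" using z by auto
  have "((\<lambda>(x, y). f (x, y)) has_derivative
      (\<lambda>(tx, ty). f1 (x, y) * tx + blinfun_mult_right (f2 (x, y)) ty)) (at (x, y) within I \<times> J)"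
  proof (rule has_derivative_partialsI)
    show "((\<lambda>x. f (x, y)) has_derivative (*) (f1 (x, y))) (at x within I)"
      using fx[OF z'(2,3)] by (simp add: has_field_derivative_def has_derivative_at_withinI)
    show "((\<lambda>y. f (x', y)) has_derivative blinfun_apply (blinfun_mult_right (f2 (x', y')))) (at y' within J)"
      if "x' \<in> I" "y' \<in> J" for x' y'
      using fy[OF that] by (simp add: has_field_derivative_def has_derivative_at_withinI blinfun_mult_right.rep_eq)
    have "continuous_on (I \<times> J) (\<lambda>z. blinfun_mult_right (f2 z))"
      by (rule bounded_linear.continuous_on[OF bounded_linear_blinfun_mult_right cont])
    then show "continuous (at (x, y) within I \<times> J) (\<lambda>(x, y). blinfun_mult_right (f2 (x, y)))"
      using z z' by (simp add: continuous_on_eq_continuous_within split_beta')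
  qed (use I z' in auto)
  moreover have "at (x, y) within I \<times> J = at (x, y)"
    using z' I by (intro at_within_open) (auto simp: open_Times)
  ultimately show ?thesis
    using z' by (simp add: split_beta' blinfun_mult_right.rep_eq mult.commute)
qed

lemma has_real_derivative_vertical:
  fixes g :: "real \<times> real \<Rightarrow> real"
  assumes "(g has_derivative D) (at (x, y))"
  shows "((\<lambda>y. g (x, y)) has_real_derivative D (0, 1)) (at y)"
proof -
  have "((\<lambda>y. (x, y)) has_derivative (\<lambda>t. (0, t))) (at y)"
    by (auto intro!: derivative_eq_intros)
  from diff_chain_at[OF this assms] have "((\<lambda>y. g (x, y)) has_derivative (\<lambda>t. D (0, t))) (at y)"
    by (simp add: o_def)
  moreover have "(\<lambda>t. D (0, t)) = (*) (D (0, 1))"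
  proof
    fix t
    show "D (0, t) = D (0, 1) * t"
      using linear_cmul[OF has_derivative_linear[OF assms], of t "(0, 1)"] by simp
  qed
  ultimately show ?thesis by (simp only: has_field_derivative_def)
qed

lemma continuous_on_primitive_param:
  fixes g :: "real \<times> real \<Rightarrow> real"
  assumes "continuous_on ({-b<..<b} \<times> J) g"
  shows "continuous_on ({-b<..<b} \<times> J) (\<lambda>z. primitive (\<lambda>x. g (x, snd z)) (fst z))"
proof -
  have "continuous_on (({-b<..<b} \<times> J) \<times> cbox 0 1) (\<lambda>(z, \<theta>). g (fst z * \<theta>, snd z))"
    unfolding split_beta
  proof (rule continuous_on_compose2[OF assms])
    show "(\<lambda>p. (fst (fst p) * snd p, snd (fst p))) ` (({-b<..<b} \<times> J) \<times> cbox 0 1) \<subseteq> {-b<..<b} \<times> J"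
    proof clarsimp
      fix x y \<theta> :: real assume "- b < x" "x < b" "0 \<le> \<theta>" "\<theta> \<le> 1"
      then show "- b < x * \<theta> \<and> x * \<theta> < b"
        using abs_mult_unit_interval_less[of x b \<theta>] by (simp add: abs_less_iff)
    qed
  qed (intro continuous_intros)
  from integral_continuous_on_param[OF this] show ?thesis
    unfolding primitive_def by (intro continuous_intros) (simp add: cbox_interval)
qed

text \<open>The horizontal derivative of the primitive is \<open>g\<close>, and the vertical one is,
  by the Leibniz rule, the primitive of the vertical derivative \<open>g2\<close>. The latter is one
  order less regular than \<open>g\<close> and falls under the induction hypothesis, so integration
  loses no order.\<close>

lemma Ck_on_primitive_param:
  fixes g :: "real \<times> real \<Rightarrow> real"
  assumes b: "open J" "convex J" and "Ck_on n ({-b<..<b} \<times> J) g"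
  shows "Ck_on n ({-b<..<b} \<times> J) (\<lambda>z. primitive (\<lambda>x. g (x, snd z)) (fst z))"
  using assms(3)
proof (induction n arbitrary: g)
  case 0
  then show ?case using continuous_on_primitive_param by simp
next
  case (Suc n)
  let ?U = "{-b<..<b} \<times> J"
  have U: "open ?U" using b(1) by (simp add: open_Times)
  define g2 where "g2 z = frechet_derivative g (at z) (0, 1)" for z
  have g2: "Ck_on n ?U g2" using Suc.prems unfolding g2_def by simp
  have cont: "continuous_on ?U g" "continuous_on ?U g2"
    using Ck_on_imp_continuous_on g2 Suc.prems by blast+
  have gy: "((\<lambda>y. g (x, y)) has_real_derivative g2 (x, y)) (at y)" if "(x, y) \<in> ?U" for x y
    unfolding g2_def
    by (rule has_real_derivative_vertical[OF Ck_on_Suc_has_derivative[OF Suc.prems that]])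
  have px: "((\<lambda>x. primitive (\<lambda>x. g (x, y)) x) has_real_derivative g (x, y)) (at x)"
    if "x \<in> {-b<..<b}" "y \<in> J" for x y
  proof (rule primitive_has_derivative)
    show "continuous_on {-b<..<b} (\<lambda>x. g (x, y))"
      by (rule continuous_on_compose2[OF cont(1)]) (use that in \<open>auto intro!: continuous_intros\<close>)
  qed (use that in auto)
  have py: "((\<lambda>y. primitive (\<lambda>x. g (x, y)) x) has_real_derivative primitive (\<lambda>x. g2 (x, y)) x) (at y)"
    if x: "x \<in> {-b<..<b}" and y: "y \<in> J" for x y
  proof -
    have in_U: "(x * \<theta>, y) \<in> ?U" if "\<theta> \<in> {0..1}" "y \<in> J" for \<theta> y
      using abs_mult_unit_interval_less[of x b \<theta>] x that by (simp add: abs_less_iff)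
    have "((\<lambda>y. integral (cbox 0 1) (\<lambda>\<theta>. g (x * \<theta>, y))) has_real_derivative
        integral (cbox 0 1) (\<lambda>\<theta>. g2 (x * \<theta>, y))) (at y within J)"
    proof (rule leibniz_rule_field_derivative)
      show "((\<lambda>y. g (x * \<theta>, y)) has_real_derivative g2 (x * \<theta>, y)) (at y within J)"
        if "y \<in> J" "\<theta> \<in> cbox 0 1" for y \<theta>
        using gy in_U that by (simp add: has_field_derivative_at_within)
      show "(\<lambda>\<theta>. g (x * \<theta>, y)) integrable_on cbox 0 1" if "y \<in> J" for y
        unfolding cbox_interval
        by (rule integrable_continuous_interval, rule continuous_on_compose2[OF cont(1)])
          (use in_U that in \<open>auto intro!: continuous_intros\<close>)
      show "continuous_on (J \<times> cbox 0 1) (\<lambda>(y, \<theta>). g2 (x * \<theta>, y))"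
        unfolding split_beta
        by (rule continuous_on_compose2[OF cont(2)])
          (use in_U in \<open>auto intro!: continuous_intros\<close>)
    qed (use y b in auto)
    then have "((\<lambda>y. integral {0..1} (\<lambda>\<theta>. g (x * \<theta>, y))) has_real_derivative
        integral {0..1} (\<lambda>\<theta>. g2 (x * \<theta>, y))) (at y)"
      using at_within_open[OF y b(1)] by (simp add: cbox_interval)
    then show ?thesis unfolding primitive_def by (rule DERIV_cmult)
  qed
  show ?case
  proof (rule Ck_on_SucI[OF U])
    show "((\<lambda>z. primitive (\<lambda>x. g (x, snd z)) (fst z)) has_derivative
        (\<lambda>v. fst v * g z + snd v * primitive (\<lambda>x. g2 (x, snd z)) (fst z))) (at z)" if "z \<in> ?U" for z
      using has_derivative_continuous_partials[where f = "\<lambda>z. primitive (\<lambda>x. g (x, snd z)) (fst z)"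
          and ?f1.0 = g and ?f2.0 = "\<lambda>z. primitive (\<lambda>x. g2 (x, snd z)) (fst z)", OF _ b _ _ _ that]
        px py continuous_on_primitive_param[OF cont(2)] by simp
    show "Ck_on n ?U (\<lambda>z. fst v * g z + snd v * primitive (\<lambda>x. g2 (x, snd z)) (fst z))" for v
      using Suc.IH[OF g2] Ck_on_SucD[OF Suc.prems]
      by (intro Ck_on_add Ck_on_bilinear[OF bounded_bilinear_mult] Ck_on_const U)
  qed
qed


section \<open>Existence of the flow by a contraction argument\<close>

lemma abs_primitive_le:
  assumes "continuous_on UNIV h" "\<And>x. \<bar>h x\<bar> \<le> B"
  shows "\<bar>primitive h x\<bar> \<le> \<bar>x\<bar> * B"
proof -
  have "norm (integral {0..1} (\<lambda>\<theta>. h (x * \<theta>))) \<le> B * (1 - 0)"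
    using assms(2) by (intro integral_bound continuous_on_compose2[OF assms(1)]) (auto intro!: continuous_intros)
  then show ?thesis by (simp add: primitive_def abs_mult mult_left_mono)
qed

lemma primitive_diff:
  assumes "continuous_on UNIV h" "continuous_on UNIV k"
  shows "primitive h x - primitive k x = primitive (\<lambda>x. h x - k x) x"
proof -
  have "(\<lambda>\<theta>. h (x * \<theta>)) integrable_on {0..1}" "(\<lambda>\<theta>. k (x * \<theta>)) integrable_on {0..1}"
    using assms by (auto intro!: integrable_continuous_interval continuous_on_compose2[OF assms(1)]
        continuous_on_compose2[OF assms(2)] continuous_intros)
  then show ?thesis by (simp add: primitive_def integral_diff right_diff_distrib)
qed

text \<open>Picard's theorem for all initial values at once. The unknown is
  \<open>w = \<phi> - y\<close>: the solution itself is unbounded in \<open>y\<close>, whereas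
  \<open>w\<close> is bounded by \<open>b * B\<close> and lives in the complete space of bounded
  continuous functions on the plane. There the integral operator contracts with factor
  \<open>b * L\<close>, and joint continuity in time and initial value is built into the
  space.\<close>

lemma integral_equation_solution:
  fixes M :: "real \<times> real \<Rightarrow> real"
  assumes M: "continuous_on UNIV M" and B: "\<And>z. \<bar>M z\<bar> \<le> B"
    and L: "\<And>x u v. \<bar>M (x, u) - M (x, v)\<bar> \<le> L * \<bar>u - v\<bar>"
    and b: "0 \<le> b" "0 \<le> L" "b * L < 1"
  obtains \<phi> where "continuous_on UNIV \<phi>"
    and "\<And>x y. \<bar>x\<bar> \<le> b \<Longrightarrow> \<phi> (x, y) = y + primitive (\<lambda>x. M (x, \<phi> (x, y))) x"
    and "\<And>x y. \<bar>x\<bar> \<le> b \<Longrightarrow> \<bar>\<phi> (x, y) - y\<bar> \<le> b * B"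
proof -
  \<comment> \<open>Freezing the upper limit of integration outside \<open>{-b..b}\<close> keeps the
    operator bounded on the whole plane and changes nothing inside.\<close>
  define \<kappa> where "\<kappa> x = max (- b) (min b x)" for x :: real
  have \<kappa>: "\<bar>\<kappa> x\<bar> \<le> b" "\<bar>x\<bar> \<le> b \<Longrightarrow> \<kappa> x = x" for x
    using b(1) by (auto simp: \<kappa>_def)
  have \<kappa>_cont: "continuous_on UNIV (\<lambda>x. \<kappa> x)"
    unfolding \<kappa>_def by (intro continuous_intros)
  define F where "F w z = primitive (\<lambda>x. M (x, snd z + w (x, snd z))) (\<kappa> (fst z))"
    for w :: "real \<times> real \<Rightarrow> real" and z :: "real \<times> real"
  have Mw: "continuous_on UNIV (\<lambda>x. M (x, y + w (x, y)))" if "continuous_on UNIV w"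
    for w :: "real \<times> real \<Rightarrow> real" and y
    by (intro continuous_on_compose2[OF M] continuous_intros continuous_on_compose2[OF that]) auto
  have F_bound: "\<bar>F w z\<bar> \<le> b * B" if "continuous_on UNIV w" for w z
  proof -
    have "\<bar>F w z\<bar> \<le> \<bar>\<kappa> (fst z)\<bar> * B"
      unfolding F_def by (rule abs_primitive_le[OF Mw[OF that] B])
    also have "\<dots> \<le> b * B"
      using \<kappa>(1) B[of 0] by (intro mult_right_mono) auto
    finally show ?thesis .
  qed
  have F_cont: "continuous_on UNIV (F w)" if w: "continuous_on UNIV w" for w
  proof -
    have "continuous_on (UNIV \<times> cbox 0 1)
      (\<lambda>(z, \<theta>). M (\<kappa> (fst z) * \<theta>, snd z + w (\<kappa> (fst z) * \<theta>, snd z)))"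
      unfolding split_beta
      by (intro continuous_on_compose2[OF M] continuous_intros continuous_on_compose2[OF w]
          continuous_on_compose2[OF \<kappa>_cont]) auto
    from integral_continuous_on_param[OF this] show ?thesis
      unfolding F_def primitive_def
      by (intro continuous_intros continuous_on_compose2[OF \<kappa>_cont]) (auto simp: cbox_interval)
  qed
  have F_lip: "\<bar>F v z - F w z\<bar> \<le> b * (L * d)"
    if v: "continuous_on UNIV v" and w: "continuous_on UNIV w" and d: "\<And>z. \<bar>v z - w z\<bar> \<le> d" for v w z d
  proof -
    let ?k = "\<lambda>x. M (x, snd z + v (x, snd z)) - M (x, snd z + w (x, snd z))"
    have "\<bar>?k x\<bar> \<le> L * d" for x
    proof -
      have "\<bar>?k x\<bar> \<le> L * \<bar>v (x, snd z) - w (x, snd z)\<bar>"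
        using L[of x "snd z + v (x, snd z)" "snd z + w (x, snd z)"] by simp
      also have "\<dots> \<le> L * d" by (rule mult_left_mono[OF d b(2)])
      finally show ?thesis .
    qed
    then have "\<bar>primitive ?k (\<kappa> (fst z))\<bar> \<le> \<bar>\<kappa> (fst z)\<bar> * (L * d)"
      by (intro abs_primitive_le continuous_on_diff Mw v w)
    also have "\<dots> \<le> b * (L * d)"
      using \<kappa>(1) b(2) d[of z] by (intro mult_right_mono) auto
    finally show ?thesis by (simp add: F_def primitive_diff[OF Mw[OF v] Mw[OF w]])
  qed
  define T where "T w = Bcontfun (F (apply_bcontfun w))" for w :: "(real \<times> real) \<Rightarrow>\<^sub>C real"
  have T: "apply_bcontfun (T w) = F (apply_bcontfun w)" for w
    unfolding T_def
    by (rule Bcontfun_inverse, rule bcontfun_normI[where b = "b * B"]) (use F_cont F_bound in auto)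
  have "dist (T v) (T w) \<le> b * L * dist v w" for v w
  proof (rule dist_bound)
    fix z
    have "\<bar>v z - w z\<bar> \<le> dist v w" for z
      using dist_bounded[of v z w] by (simp add: dist_real_def)
    from F_lip[OF continuous_on_apply_bcontfun continuous_on_apply_bcontfun this, of z] show "dist (T v z) (T w z) \<le> b * L * dist v w"
      by (simp add: T dist_real_def mult.assoc)
  qed
  then obtain w where "T w = w"
    using banach_fix_type[of "b * L" T] b by auto
  then have w: "w z = F w z" for z using T by metis
  define \<phi> where "\<phi> z = snd z + w z" for z :: "real \<times> real"
  show ?thesis
  proof (rule that)
    show "continuous_on UNIV \<phi>" unfolding \<phi>_def
      by (intro continuous_on_add continuous_on_snd continuous_on_id continuous_on_apply_bcontfun)
    show "\<phi> (x, y) = y + primitive (\<lambda>x. M (x, \<phi> (x, y))) x" if "\<bar>x\<bar> \<le> b" for x y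
      using w[of "(x, y)"] \<kappa>(2)[OF that] by (simp add: \<phi>_def F_def)
    show "\<bar>\<phi> (x, y) - y\<bar> \<le> b * B" if "\<bar>x\<bar> \<le> b" for x y
      using w[of "(x, y)"] F_bound[OF continuous_on_apply_bcontfun, of w "(x, y)"] by (simp add: \<phi>_def)
  qed
qed

definition clamp_interval :: "real \<Rightarrow> real \<Rightarrow> real" where
  "clamp_interval a x = max (- a) (min a x)"

lemma vertical_mean_value_bound:
  fixes m :: "real \<times> real \<Rightarrow> real"
  assumes sub: "{-a..a} \<times> {-a..a} \<subseteq> S" and m: "smooth_on S m"
    and L: "\<And>z. z \<in> {-a..a} \<times> {-a..a} \<Longrightarrow> \<bar>frechet_derivative m (at z) (0, 1)\<bar> \<le> L"
    and "x \<in> {-a..a}" "u \<in> {-a..a}" "v \<in> {-a..a}"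
  shows "\<bar>m (x, u) - m (x, v)\<bar> \<le> L * \<bar>u - v\<bar>"
proof -
  have "norm (m (x, u) - m (x, v)) \<le> L * norm (u - v)"
  proof (rule field_differentiable_bound[where S = "{-a..a}"
        and f' = "\<lambda>y. frechet_derivative m (at (x, y)) (0, 1)"])
    fix y assume y: "y \<in> {-a..a}"
    have D: "(m has_derivative frechet_derivative m (at (x, y))) (at (x, y))"
      by (rule smooth_on_has_derivative[OF m]) (use sub assms(4) y in auto)
    from has_real_derivative_vertical[OF this]
    show "((\<lambda>y. m (x, y)) has_field_derivative frechet_derivative m (at (x, y)) (0, 1)) (at y within {-a..a})"
      by (rule has_field_derivative_at_within)
    show "norm (frechet_derivative m (at (x, y)) (0, 1)) \<le> L"
      using L assms(4) y by simp
  qed (use assms in auto)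
  then show ?thesis by simp
qed

text \<open>The last conclusion keeps the whole segment between two solutions at equal time inside
  the domain of \<open>m\<close>, because the difference quotient of the flow will be expressed by
  an integral over that segment. It holds since the solutions stay in a square contained in
  \<open>S\<close>, and a square is convex.\<close>

lemma flow_exists:
  fixes m :: "real \<times> real \<Rightarrow> real"
  assumes S: "open S" "0 \<in> S" and m: "smooth_on S m"
  obtains b \<phi> where "b > 0" "continuous_on UNIV \<phi>"
    and "\<And>x y. \<bar>x\<bar> < b \<Longrightarrow> \<bar>y\<bar> < b \<Longrightarrow> (x, \<phi> (x, y)) \<in> S"
    and "\<And>y. \<phi> (0, y) = y"
    and "\<And>x y. \<bar>x\<bar> < b \<Longrightarrow> \<bar>y\<bar> < b \<Longrightarrow> ((\<lambda>x. \<phi> (x, y)) has_real_derivative m (x, \<phi> (x, y))) (at x)"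
    and "\<And>x y y'. \<bar>x\<bar> < b \<Longrightarrow> \<bar>y\<bar> < b \<Longrightarrow> \<bar>y'\<bar> < b \<Longrightarrow> closed_segment (\<phi> (x, y)) (\<phi> (x, y')) \<subseteq> {u. (x, u) \<in> S}"
proof -
  obtain e where e: "e > 0" "cball 0 e \<subseteq> S" using S open_contains_cball by blast
  \<comment> \<open>A point of the square of half-width \<open>a\<close> has norm at most
    \<open>2 * a = e\<close>.\<close>
  define a where "a = e / 2"
  have a: "a > 0" using e by (simp add: a_def)
  let ?Q = "{-a..a} \<times> {-a..a}"
  have Q: "?Q \<subseteq> S"
  proof
    fix z assume "z \<in> ?Q"
    then have "norm (fst z) \<le> a" "norm (snd z) \<le> a" by auto
    then have "norm z \<le> e" using norm_Pair_le[of "fst z" "snd z"] by (simp add: a_def)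
    then show "z \<in> S" using e by auto
  qed
  have comp: "compact ?Q" by (intro compact_Times compact_Icc)
  have "continuous_on ?Q m" "continuous_on ?Q (\<lambda>z. frechet_derivative m (at z) (0, 1))"
    using m smooth_on_frechet_derivative[OF m] smooth_on_imp_continuous_on continuous_on_subset[OF _ Q] by blast+
  note bdd = compact_continuous_image[OF this(1) comp, THEN compact_imp_bounded]
    compact_continuous_image[OF this(2) comp, THEN compact_imp_bounded]
  then obtain B L where B: "B > 0" "\<And>z. z \<in> ?Q \<Longrightarrow> \<bar>m z\<bar> \<le> B"
    and L: "L > 0" "\<And>z. z \<in> ?Q \<Longrightarrow> \<bar>frechet_derivative m (at z) (0, 1)\<bar> \<le> L"
    unfolding bounded_pos by (metis image_eqI real_norm_def)
  let ?c = "clamp_interval a"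
  have c: "?c x \<in> {-a..a}" "x \<in> {-a..a} \<Longrightarrow> ?c x = x" "\<bar>?c x - ?c y\<bar> \<le> \<bar>x - y\<bar>" for x y
    using a by (auto simp: clamp_interval_def)
  \<comment> \<open>Clamping makes the right-hand side globally bounded and Lipschitz; near \<open>0\<close> the solution does not notice it.\<close>
  define M where "M z = m (?c (fst z), ?c (snd z))" for z :: "real \<times> real"
  have contM: "continuous_on UNIV M"
    unfolding M_def
  proof (rule continuous_on_compose2[OF \<open>continuous_on ?Q m\<close>])
    show "continuous_on UNIV (\<lambda>z. (?c (fst z), ?c (snd z)))"
      unfolding clamp_interval_def by (intro continuous_intros)
    show "(\<lambda>z. (?c (fst z), ?c (snd z))) ` UNIV \<subseteq> ?Q" using c(1) by blast
  qed
  have M_lip: "\<bar>M (x, u) - M (x, v)\<bar> \<le> L * \<bar>u - v\<bar>" for x u v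
  proof -
    have "\<bar>M (x, u) - M (x, v)\<bar> \<le> L * \<bar>?c u - ?c v\<bar>"
      unfolding M_def fst_conv snd_conv by (rule vertical_mean_value_bound[OF Q m L(2) c(1) c(1) c(1)])
    also have "\<dots> \<le> L * \<bar>u - v\<bar>" using c(3) L(1) by (intro mult_left_mono) auto
    finally show ?thesis .
  qed
  \<comment> \<open>In this order: times and initial values stay below \<open>a / 2\<close>; a
    solution moves by at most \<open>b * B \<le> a / 2\<close>, hence remains in the square; the
    contraction factor \<open>b * L\<close> is at most \<open>1 / 2\<close>.\<close>
  define b where "b = Min {a / 2, a / (2 * B), 1 / (2 * L)}"
  have b: "b > 0" "b \<le> a / 2" "b \<le> a / (2 * B)" "b \<le> 1 / (2 * L)"
    using a B L by (auto simp: b_def)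
  have bB: "b * B \<le> a / 2" and bL: "b * L < 1"
    using b B(1) L(1) by (auto simp: field_simps)
  obtain \<phi> where \<phi>: "continuous_on UNIV \<phi>"
    "\<And>x y. \<bar>x\<bar> \<le> b \<Longrightarrow> \<phi> (x, y) = y + primitive (\<lambda>x. M (x, \<phi> (x, y))) x"
    "\<And>x y. \<bar>x\<bar> \<le> b \<Longrightarrow> \<bar>\<phi> (x, y) - y\<bar> \<le> b * B"
    by (rule integral_equation_solution[OF contM _ M_lip less_imp_le[OF b(1)] less_imp_le[OF L(1)] bL, of B])
      (use B(2) c(1) in \<open>auto simp: M_def\<close>)
  have \<phi>Q: "x \<in> {-a..a}" "\<phi> (x, y) \<in> {-a..a}" if "\<bar>x\<bar> < b" "\<bar>y\<bar> < b" for x y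
    using \<phi>(3)[of x y] that b(2) bB by (auto simp: abs_le_iff abs_less_iff)
  show ?thesis
  proof (rule that[OF b(1) \<phi>(1)])
    show "(x, \<phi> (x, y)) \<in> S" if "\<bar>x\<bar> < b" "\<bar>y\<bar> < b" for x y
      using \<phi>Q[OF that] Q by auto
    show "\<phi> (0, y) = y" for y using \<phi>(2)[of 0 y] b(1) by simp
    show "((\<lambda>x. \<phi> (x, y)) has_real_derivative m (x, \<phi> (x, y))) (at x)"
      if xy: "\<bar>x\<bar> < b" "\<bar>y\<bar> < b" for x y
    proof -
      have "continuous_on {-b<..<b} (\<lambda>x. M (x, \<phi> (x, y)))"
        by (intro continuous_on_compose2[OF contM] continuous_intros continuous_on_compose2[OF \<phi>(1)]) auto
      from primitive_has_derivative[OF this xy(1)]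
      have "((\<lambda>x. y + primitive (\<lambda>x. M (x, \<phi> (x, y))) x) has_real_derivative M (x, \<phi> (x, y))) (at x)"
        by (auto intro!: derivative_eq_intros)
      then have "((\<lambda>x. \<phi> (x, y)) has_real_derivative M (x, \<phi> (x, y))) (at x)"
        by (rule has_field_derivative_transform_within_open[where S = "{-b<..<b}"])
          (use \<phi>(2) xy in auto)
      then show ?thesis using c(2) \<phi>Q[OF xy] by (simp add: M_def)
    qed
    show "closed_segment (\<phi> (x, y)) (\<phi> (x, y')) \<subseteq> {u. (x, u) \<in> S}"
      if "\<bar>x\<bar> < b" "\<bar>y\<bar> < b" "\<bar>y'\<bar> < b" for x y y'
    proof -
      have "closed_segment (\<phi> (x, y)) (\<phi> (x, y')) \<subseteq> {-a..a}"
        by (rule closed_segment_subset) (use \<phi>Q that in auto)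
      then show ?thesis using \<phi>Q(1)[OF that(1,2)] Q by auto
    qed
  qed
qed


section \<open>Smooth dependence of the flow on the initial value\<close>

lemma mean_slope:
  fixes h h' :: "real \<Rightarrow> real"
  assumes h: "\<And>y. y \<in> closed_segment u v \<Longrightarrow> (h has_real_derivative h' y) (at y)"
  shows "((\<lambda>\<theta>. h' (u + \<theta> * (v - u)) * (v - u)) has_integral (h v - h u)) {0..1}"
proof -
  have seg: "u + \<theta> * (v - u) \<in> closed_segment u v" if "\<theta> \<in> {0..1}" for \<theta>
    using that unfolding in_segment by (auto intro!: exI[of _ \<theta>] simp: algebra_simps)
  have "((\<lambda>\<theta>. h' (u + \<theta> * (v - u)) * (v - u)) has_integral
      (h (u + 1 * (v - u)) - h (u + 0 * (v - u)))) {0..1}"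
  proof (rule fundamental_theorem_of_calculus)
    fix \<theta> :: real assume "\<theta> \<in> {0..1}"
    from h[OF seg[OF this]]
    have "((\<lambda>\<theta>. h (u + \<theta> * (v - u))) has_real_derivative h' (u + \<theta> * (v - u)) * (v - u)) (at \<theta>)"
      by (rule DERIV_chain2[where f = h and g = "\<lambda>\<theta>. u + \<theta> * (v - u)"])
        (auto intro!: derivative_eq_intros)
    then show "((\<lambda>\<theta>. h (u + \<theta> * (v - u))) has_vector_derivative h' (u + \<theta> * (v - u)) * (v - u))
        (at \<theta> within {0..1})"
      by (simp add: has_real_derivative_iff_has_vector_derivative has_vector_derivative_at_within)
  qed simp
  then show ?thesis by simp
qed

text \<open>Integrating factor: \<open>d\<close> times the exponential of minus the primitive of
  \<open>q\<close> has derivative zero.\<close>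

lemma scalar_linear_ode:
  fixes d q :: "real \<Rightarrow> real"
  assumes q: "continuous_on {-b<..<b} q"
    and d: "\<And>x. \<bar>x\<bar> < b \<Longrightarrow> (d has_real_derivative q x * d x) (at x)"
    and x: "\<bar>x\<bar> < b"
  shows "d x = d 0 * exp (primitive q x)"
proof -
  define e where "e x = d x * exp (- primitive q x)" for x
  have "\<exists>c. \<forall>x\<in>{-b<..<b}. e x = c"
  proof (rule has_field_derivative_zero_constant)
    fix x assume "x \<in> {-b<..<b}"
    then have x: "\<bar>x\<bar> < b" by auto
    have "(e has_real_derivative 0) (at x)"
      unfolding e_def
      by (rule derivative_eq_intros d[OF x] primitive_has_derivative[OF q x] refl)+ (simp add: algebra_simps)
    then show "(e has_real_derivative 0) (at x within {-b<..<b})"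
      by (rule has_field_derivative_at_within)
  qed simp
  then have "e x = e 0" using x by fastforce
  then show ?thesis by (simp add: e_def exp_minus field_simps)
qed

text \<open>\<open>E\<close> is the derivative of the flow in its initial value, positive because it
  is an exponential. Both partial derivatives, \<open>m (fst z, \<phi> z)\<close> and
  \<open>E z\<close>, are expressed through \<open>\<phi>\<close> without losing an order; hence
  regularity of order n of \<open>\<phi>\<close> passes to its derivative and gives order n +
  1.\<close>

lemma smooth_flow:
  fixes m :: "real \<times> real \<Rightarrow> real"
  assumes S: "open S" "0 \<in> S" and m: "smooth_on S m"
  obtains b \<phi> E where "b > 0" "smooth_on ({-b<..<b} \<times> {-b<..<b}) \<phi>"
    and "\<And>y. \<phi> (0, y) = y"
    and "\<And>z. z \<in> {-b<..<b} \<times> {-b<..<b} \<Longrightarrow> (fst z, \<phi> z) \<in> S"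
    and "\<And>z. E z > 0"
    and "\<And>z. z \<in> {-b<..<b} \<times> {-b<..<b} \<Longrightarrow>
      (\<phi> has_derivative (\<lambda>v. fst v * m (fst z, \<phi> z) + snd v * E z)) (at z)"
proof -
  obtain b \<phi> where b: "b > 0" and cont_\<phi>: "continuous_on UNIV \<phi>"
    and \<phi>S: "\<And>x y. \<bar>x\<bar> < b \<Longrightarrow> \<bar>y\<bar> < b \<Longrightarrow> (x, \<phi> (x, y)) \<in> S"
    and \<phi>0: "\<And>y. \<phi> (0, y) = y"
    and \<phi>x: "\<And>x y. \<bar>x\<bar> < b \<Longrightarrow> \<bar>y\<bar> < b \<Longrightarrow>
      ((\<lambda>x. \<phi> (x, y)) has_real_derivative m (x, \<phi> (x, y))) (at x)"
    and seg: "\<And>x y y'. \<bar>x\<bar> < b \<Longrightarrow> \<bar>y\<bar> < b \<Longrightarrow> \<bar>y'\<bar> < b \<Longrightarrow>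
      closed_segment (\<phi> (x, y)) (\<phi> (x, y')) \<subseteq> {u. (x, u) \<in> S}"
    using flow_exists[OF assms] by blast
  let ?I = "{-b<..<b}"
  have U: "open (?I \<times> ?I)" by (intro open_Times) auto
  define m2 where "m2 z = frechet_derivative m (at z) (0, 1)" for z
  have smooth_m2: "smooth_on S m2"
    unfolding m2_def by (rule smooth_on_frechet_derivative[OF m])
  note cont_m2 = smooth_on_imp_continuous_on[OF smooth_m2]
  have my: "((\<lambda>y. m (x, y)) has_real_derivative m2 (x, y)) (at y)" if "(x, y) \<in> S" for x y
    unfolding m2_def by (rule has_real_derivative_vertical[OF smooth_on_has_derivative[OF m that]])
  \<comment> \<open>The difference of two solutions solves a linear equation with coefficient \<open>q\<close> (Hadamard's lemma), which
    gives its quotient by the difference of the initial values in closed form, continuous up to the diagonal.\<close>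
  define q where "q y z = integral {0..1} (\<lambda>\<theta>. m2 (fst z, \<phi> (fst z, y) + \<theta> * (\<phi> z - \<phi> (fst z, y))))"
    for y and z :: "real \<times> real"
  have cont_q: "continuous_on (?I \<times> ?I) (q y)" if y: "y \<in> ?I" for y
  proof -
    have "continuous_on ((?I \<times> ?I) \<times> cbox 0 1)
        (\<lambda>(z, \<theta>). m2 (fst z, \<phi> (fst z, y) + \<theta> * (\<phi> z - \<phi> (fst z, y))))"
      unfolding split_beta
    proof (rule continuous_on_compose2[OF cont_m2])
      show "continuous_on ((?I \<times> ?I) \<times> cbox 0 1) (\<lambda>p. (fst (fst p),
          \<phi> (fst (fst p), y) + snd p * (\<phi> (fst p) - \<phi> (fst (fst p), y))))"
        by (intro continuous_intros continuous_on_compose2[OF cont_\<phi>]) auto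
      have "(x, \<phi> (x, y) + \<theta> * (\<phi> (x, y') - \<phi> (x, y))) \<in> S"
        if "x \<in> ?I" "y' \<in> ?I" "\<theta> \<in> {0..1}" for x y' \<theta>
      proof -
        have "\<phi> (x, y) + \<theta> * (\<phi> (x, y') - \<phi> (x, y)) \<in> closed_segment (\<phi> (x, y)) (\<phi> (x, y'))"
          using that(3) unfolding in_segment by (auto intro!: exI[of _ \<theta>] simp: algebra_simps)
        moreover have "\<bar>x\<bar> < b" "\<bar>y\<bar> < b" "\<bar>y'\<bar> < b" using y that by auto
        ultimately show ?thesis using seg[of x y y'] by blast
      qed
      then show "(\<lambda>p. (fst (fst p), \<phi> (fst (fst p), y) + snd p * (\<phi> (fst p) - \<phi> (fst (fst p), y))))
          ` ((?I \<times> ?I) \<times> cbox 0 1) \<subseteq> S"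
        by (auto simp: cbox_interval)
    qed
    from integral_continuous_on_param[OF this] show ?thesis
      unfolding q_def by (simp add: cbox_interval)
  qed
  define G where "G y z = primitive (\<lambda>x. q y (x, snd z)) (fst z)" for y z
  have cont_G: "continuous_on (?I \<times> ?I) (G y)" if "y \<in> ?I" for y
    unfolding G_def by (rule continuous_on_primitive_param[OF cont_q[OF that]])
  have slope: "\<phi> (x, y') - \<phi> (x, y) = (y' - y) * exp (G y (x, y'))"
    if x: "x \<in> ?I" and y: "y \<in> ?I" and y': "y' \<in> ?I" for x y y'
  proof -
    have "\<phi> (x, y') - \<phi> (x, y) = (\<phi> (0, y') - \<phi> (0, y)) * exp (primitive (\<lambda>x. q y (x, y')) x)"
    proof (rule scalar_linear_ode)
      show "continuous_on ?I (\<lambda>x. q y (x, y'))"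
        by (rule continuous_on_compose2[OF cont_q[OF y]]) (use y' in \<open>auto intro!: continuous_intros\<close>)
      fix x assume x: "\<bar>x\<bar> < b"
      \<comment> \<open>The increment of \<open>m\<close> between the two solutions factors as
        \<open>q y (x, y')\<close> times their difference, which makes the equation for the
        difference linear.\<close>
      have "((\<lambda>\<theta>. m2 (x, \<phi> (x, y) + \<theta> * (\<phi> (x, y') - \<phi> (x, y))) * (\<phi> (x, y') - \<phi> (x, y)))
          has_integral (m (x, \<phi> (x, y')) - m (x, \<phi> (x, y)))) {0..1}"
      proof (rule mean_slope)
        have "\<bar>y\<bar> < b" "\<bar>y'\<bar> < b" using y y' by auto
        then show "((\<lambda>y. m (x, y)) has_real_derivative m2 (x, u)) (at u)"
          if "u \<in> closed_segment (\<phi> (x, y)) (\<phi> (x, y'))" for u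
          using my seg[of x y y'] x that by blast
      qed
      from integral_unique[OF this]
      have "m (x, \<phi> (x, y')) - m (x, \<phi> (x, y)) = q y (x, y') * (\<phi> (x, y') - \<phi> (x, y))"
        by (simp add: q_def)
      then show "((\<lambda>x. \<phi> (x, y') - \<phi> (x, y)) has_real_derivative q y (x, y') * (\<phi> (x, y') - \<phi> (x, y))) (at x)"
        using DERIV_diff[OF \<phi>x[OF x] \<phi>x[OF x], of y' y] y y' by auto
    qed (use x in auto)
    then show ?thesis by (simp add: \<phi>0 G_def)
  qed
  define E where "E z = exp (primitive (\<lambda>x. m2 (x, \<phi> (x, snd z))) (fst z))" for z :: "real \<times> real"
  \<comment> \<open>For equal initial values the segment collapses to a point, and the integrand of
    \<open>q\<close> no longer depends on \<open>\<theta>\<close>.\<close>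
  have G_diag: "exp (G y (x, y)) = E (x, y)" for x y
    by (simp add: G_def E_def q_def)
  have \<phi>y: "((\<lambda>y. \<phi> (x, y)) has_real_derivative E (x, y)) (at y)" if x: "x \<in> ?I" and y: "y \<in> ?I" for x y
  proof -
    have "continuous_on ?I (\<lambda>y'. G y (x, y'))"
      by (rule continuous_on_compose2[OF cont_G[OF y]]) (use x in \<open>auto intro!: continuous_intros\<close>)
    then have "isCont (\<lambda>y'. exp (G y (x, y'))) y"
      using y by (intro isCont_exp') (auto simp: continuous_on_eq_continuous_at)
    then have "((\<lambda>y'. exp (G y (x, y'))) \<longlongrightarrow> E (x, y)) (at y)"
      by (simp add: isCont_def G_diag)
    then have "((\<lambda>y'. (\<phi> (x, y') - \<phi> (x, y)) / (y' - y)) \<longlongrightarrow> E (x, y)) (at y)"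
      by (rule Lim_transform_within_open[where s = ?I]) (use slope x y in auto)
    then show ?thesis by (simp add: has_field_derivative_iff)
  qed
  have pair_S: "(\<lambda>z. (fst z, \<phi> z)) ` (?I \<times> ?I) \<subseteq> S" using \<phi>S by auto
  have CkE: "Ck_on n (?I \<times> ?I) E" if n: "Ck_on n (?I \<times> ?I) \<phi>" for n
  proof -
    have "Ck_on n (?I \<times> ?I) (\<lambda>z. m2 (fst z, \<phi> z))"
      by (rule Ck_on_compose[OF U S(1) pair_S Ck_on_Pair[OF U _ n]])
        (use smooth_m2 U smooth_on_bounded_linear[OF bounded_linear_fst U] in \<open>auto simp: smooth_on_def\<close>)
    from Ck_on_primitive_param[OF _ _ this] have "Ck_on n (?I \<times> ?I) (\<lambda>z. primitive (\<lambda>x. m2 (x, \<phi> (x, snd z))) (fst z))"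
      by simp
    then show ?thesis unfolding E_def by (rule Ck_on_exp[OF U])
  qed
  have cont_\<phi>U: "continuous_on (?I \<times> ?I) \<phi>" using cont_\<phi> continuous_on_subset by blast
  have D: "(\<phi> has_derivative (\<lambda>v. fst v * m (fst z, \<phi> z) + snd v * E z)) (at z)" if z: "z \<in> ?I \<times> ?I" for z
  proof (rule has_derivative_continuous_partials[where ?f1.0 = "\<lambda>z. m (fst z, \<phi> z)", OF _ _ _ _ _ _ z])
    show "continuous_on (?I \<times> ?I) E" using CkE[of 0] cont_\<phi>U by simp
    show "((\<lambda>x. \<phi> (x, y)) has_real_derivative m (fst (x, y), \<phi> (x, y))) (at x)"
      if "x \<in> ?I" "y \<in> ?I" for x y using \<phi>x[of x y] that by auto
  qed (use \<phi>y in auto)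
  have "Ck_on n (?I \<times> ?I) \<phi>" for n
  proof (induction n)
    case 0
    show ?case using cont_\<phi>U by simp
  next
    case (Suc n)
    have "Ck_on n (?I \<times> ?I) (\<lambda>z. m (fst z, \<phi> z))"
      by (rule Ck_on_compose[OF U S(1) pair_S Ck_on_Pair[OF U _ Suc]])
        (use m U smooth_on_bounded_linear[OF bounded_linear_fst U] in \<open>auto simp: smooth_on_def\<close>)
    with CkE[OF Suc] show ?case
      by (intro Ck_on_SucI[OF U D] Ck_on_add Ck_on_bilinear[OF bounded_bilinear_mult] Ck_on_const U)
  qed
  then have "smooth_on (?I \<times> ?I) \<phi>" by (simp add: smooth_on_def)
  show ?thesis
  proof (rule that[OF b \<open>smooth_on (?I \<times> ?I) \<phi>\<close> \<phi>0 _ _ D])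
    show "(fst z, \<phi> z) \<in> S" if "z \<in> ?I \<times> ?I" for z using pair_S that by blast
    show "E z > 0" for z by (simp add: E_def)
  qed
qed


section \<open>Null coordinates of a Lorentzian metric on a plane domain\<close>

text \<open>\<open>\<Psi>\<close> maps new coordinates to old ones, so it is the inverse of a
  coordinate map. In this direction metrics pull back and successive changes compose without
  inverses. The base points are carried along because each step may shrink the domain.\<close>

definition local_coordinates ::
  "(real \<times> real) set \<Rightarrow> real \<times> real \<Rightarrow> (real \<times> real) set \<Rightarrow> real \<times> real \<Rightarrow> (real \<times> real \<Rightarrow> real \<times> real) \<Rightarrow> bool" where
  "local_coordinates S z0 V z1 \<Psi> \<longleftrightarrow>
     diffeomorphism V (\<Psi> ` V) \<Psi> \<and> \<Psi> ` V \<subseteq> S \<and> z1 \<in> V \<and> \<Psi> z1 = z0"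

lemma local_coordinatesD:
  assumes "local_coordinates S z0 V z1 \<Psi>"
  shows "open V" "smooth_on V \<Psi>" "inj_on \<Psi> V" "z \<in> V \<Longrightarrow> \<Psi> z \<in> S" "z1 \<in> V" "\<Psi> z1 = z0"
  using assms by (auto simp: local_coordinates_def diffeomorphism_def bij_betw_def)

lemma local_coordinates_compose:
  assumes "local_coordinates S z0 V z1 \<Psi>" "local_coordinates V z1 U z2 \<Phi>"
  shows "local_coordinates S z0 U z2 (\<lambda>z. \<Psi> (\<Phi> z))"
proof -
  have "diffeomorphism U (\<Psi> ` \<Phi> ` U) (\<lambda>z. \<Psi> (\<Phi> z))"
    by (rule diffeomorphism_compose[of _ "\<Phi> ` U" _ V "\<Psi> ` V"])
      (use assms in \<open>auto simp: local_coordinates_def\<close>)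
  then show ?thesis
    using assms by (auto simp: local_coordinates_def image_image)
qed

lemma local_coordinates_restrict:
  assumes "local_coordinates S z0 V z1 \<Psi>" "open V'" "V' \<subseteq> V" "z1 \<in> V'"
  shows "local_coordinates S z0 V' z1 \<Psi>"
  using assms diffeomorphism_restrict[OF _ assms(2,3)] unfolding local_coordinates_def by blast

lemma local_coordinates_mono:
  "local_coordinates S z0 V z1 \<Psi> \<Longrightarrow> S \<subseteq> T \<Longrightarrow> local_coordinates T z0 V z1 \<Psi>"
  by (auto simp: local_coordinates_def)

lemma frechet_derivative_linear:
  fixes L :: "real \<times> real \<Rightarrow> real \<times> real"
  assumes "linear L"
  shows "frechet_derivative L (at z) = L"
  using frechet_derivative_at[OF linear_imp_has_derivative[OF assms]] by simp

lemma local_coordinates_linear: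
  assumes S: "open S" "z0 \<in> S" and L: "linear L" "det2 L \<noteq> 0"
  obtains V z1 where "local_coordinates S z0 V z1 L"
proof -
  have bl: "bounded_linear L" using L(1) by (simp add: linear_conv_bounded_linear)
  have V: "open (L -` S)"
    using S(1) by (rule open_vimage) (rule linear_continuous_on[OF bl])
  note expand = linear_prod_real[OF L(1)]
  have "inj L"
  proof (rule linear_injective_0[THEN iffD2, OF L(1)], intro allI impI)
    fix v assume v: "L v = 0"
    have "fst v * fst (L (1, 0)) + snd v * fst (L (0, 1)) = 0"
      "fst v * snd (L (1, 0)) + snd v * snd (L (0, 1)) = 0"
      using v expand[of v] by (simp_all add: prod_eq_iff)
    then have "fst v * det2 L = 0" "snd v * det2 L = 0"
      unfolding det2_def by algebra+
    then show "v = 0" using L(2) by (simp add: prod_eq_iff)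
  qed
  then have "surj L" by (rule linear_injective_imp_surjective[OF L(1)]) simp
  then obtain z1 where z1: "L z1 = z0" by (metis surjD)
  have "diffeomorphism (L -` S) (L ` (L -` S)) L"
    using smooth_on_bounded_linear[OF bl V] inj_on_subset[OF \<open>inj L\<close>] L
    by (intro diffeomorphism_if_det2_nonzero V) (auto simp: frechet_derivative_linear)
  then have "local_coordinates S z0 (L -` S) z1 L"
    using z1 S by (auto simp: local_coordinates_def)
  then show ?thesis by (rule that)
qed

text \<open>The conditions copy those that \<open>lorentz_metric\<close> imposes within a single
  chart, so that null coordinates can be constructed on a plane domain before any atlas
  enters.\<close>

definition lorentz_field :: "(real \<times> real) set \<Rightarrow> (real \<times> real \<Rightarrow> real \<times> real \<Rightarrow> real \<times> real \<Rightarrow> real) \<Rightarrow> bool" where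
  "lorentz_field S h \<longleftrightarrow> open S \<and>
     (\<forall>z\<in>S. bilinear (h z) \<and> (\<forall>v w. h z v w = h z w v) \<and>
        (\<exists>e1 e2. h z e1 e1 = 1 \<and> h z e2 e2 = -1 \<and> h z e1 e2 = 0)) \<and>
     (\<forall>v w. smooth_on S (\<lambda>z. h z v w))"

definition pullback :: "(real \<times> real \<Rightarrow> real \<times> real) \<Rightarrow> (real \<times> real \<Rightarrow> real \<times> real \<Rightarrow> real \<times> real \<Rightarrow> real)
    \<Rightarrow> real \<times> real \<Rightarrow> real \<times> real \<Rightarrow> real \<times> real \<Rightarrow> real" where
  "pullback \<Psi> h z v w = h (\<Psi> z) (frechet_derivative \<Psi> (at z) v) (frechet_derivative \<Psi> (at z) w)"

lemma lorentz_field_expand: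
  assumes "lorentz_field S h" "z \<in> S"
  shows "h z v w = fst v * fst w * h z (1, 0) (1, 0)
    + (fst v * snd w + snd v * fst w) * h z (1, 0) (0, 1) + snd v * snd w * h z (0, 1) (0, 1)"
proof -
  have bil: "linear (\<lambda>v. h z v w)" "linear (h z v)" and sym: "h z v w = h z w v" for v w
    using assms unfolding lorentz_field_def bilinear_def by blast+
  have "h z v w = fst v * h z (1, 0) w + snd v * h z (0, 1) w"
    using linear_prod_real[OF bil(1)[of w], of v] by simp
  moreover have "h z u w = fst w * h z u (1, 0) + snd w * h z u (0, 1)" for u
    using linear_prod_real[OF bil(2)[of u], of w] by simp
  ultimately show ?thesis
    using sym[of "(0, 1)" "(1, 0)"] by (simp add: algebra_simps)
qed

text \<open>Smoothness of \<open>h\<close> is given for constant arguments, whereas the pullback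
  inserts vectors that vary with the point; expanding in the components of \<open>h\<close> reduces
  to the given case. An orthonormal pair is transported by the inverse of the derivative.\<close>

lemma lorentz_field_pullback:
  assumes h: "lorentz_field S h" and \<Psi>: "local_coordinates S z0 V z1 \<Psi>"
  shows "lorentz_field V (pullback \<Psi> h)"
proof -
  note \<Psi>' = local_coordinatesD[OF \<Psi>]
  have S: "open S" using h by (simp add: lorentz_field_def)
  have diff: "diffeomorphism V (\<Psi> ` V) \<Psi>" using \<Psi> by (simp add: local_coordinates_def)
  have "bilinear (pullback \<Psi> h z) \<and> (\<forall>v w. pullback \<Psi> h z v w = pullback \<Psi> h z w v) \<and>
     (\<exists>e1 e2. pullback \<Psi> h z e1 e1 = 1 \<and> pullback \<Psi> h z e2 e2 = -1 \<and> pullback \<Psi> h z e1 e2 = 0)"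
    if z: "z \<in> V" for z
  proof (intro conjI)
    let ?D = "frechet_derivative \<Psi> (at z)"
    have lin: "linear ?D"
      by (rule has_derivative_linear[OF smooth_on_has_derivative[OF \<Psi>'(2) z]])
    have hz: "bilinear (h (\<Psi> z))" "\<And>v w. h (\<Psi> z) v w = h (\<Psi> z) w v"
      "\<exists>e1 e2. h (\<Psi> z) e1 e1 = 1 \<and> h (\<Psi> z) e2 e2 = -1 \<and> h (\<Psi> z) e1 e2 = 0"
      using h \<Psi>'(4)[OF z] unfolding lorentz_field_def by blast+
    have "linear (\<lambda>v. h (\<Psi> z) v w)" "linear (h (\<Psi> z) v)" for v w
      using hz(1) unfolding bilinear_def by blast+
    then show "bilinear (pullback \<Psi> h z)"
      using linear_compose[OF lin] unfolding bilinear_def pullback_def o_def by blast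
    show "\<forall>v w. pullback \<Psi> h z v w = pullback \<Psi> h z w v"
      using hz(2) by (simp add: pullback_def)
    obtain e1 e2 where e: "h (\<Psi> z) e1 e1 = 1 \<and> h (\<Psi> z) e2 e2 = -1 \<and> h (\<Psi> z) e1 e2 = 0"
      using hz(3) by blast
    obtain K where "\<And>w. ?D (K w) = w"
      using diffeomorphism_inverse_derivative(2)[OF diff z] by blast
    with e have "pullback \<Psi> h z (K e1) (K e1) = 1 \<and> pullback \<Psi> h z (K e2) (K e2) = -1
      \<and> pullback \<Psi> h z (K e1) (K e2) = 0"
      by (simp add: pullback_def)
    then show "\<exists>e1 e2. pullback \<Psi> h z e1 e1 = 1 \<and> pullback \<Psi> h z e2 e2 = -1 \<and> pullback \<Psi> h z e1 e2 = 0"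
      by blast
  qed
  moreover have "smooth_on V (\<lambda>z. pullback \<Psi> h z v w)" for v w
  proof -
    have hs: "smooth_on V (\<lambda>z. h (\<Psi> z) v w)" for v w
    proof (rule smooth_on_compose[OF \<Psi>'(1) S _ \<Psi>'(2)])
      show "\<Psi> ` V \<subseteq> S" "smooth_on S (\<lambda>z. h z v w)"
        using h \<Psi> unfolding lorentz_field_def local_coordinates_def by blast+
    qed
    have Ds: "smooth_on V (\<lambda>z. frechet_derivative \<Psi> (at z) v)" for v
      by (rule smooth_on_frechet_derivative[OF \<Psi>'(2)])
    let ?v = "\<lambda>z. frechet_derivative \<Psi> (at z) v" and ?w = "\<lambda>z. frechet_derivative \<Psi> (at z) w"
    have "smooth_on V (\<lambda>z. fst (?v z) * fst (?w z) * h (\<Psi> z) (1, 0) (1, 0)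
      + (fst (?v z) * snd (?w z) + snd (?v z) * fst (?w z)) * h (\<Psi> z) (1, 0) (0, 1)
      + snd (?v z) * snd (?w z) * h (\<Psi> z) (0, 1) (0, 1))"
      by (intro smooth_on_add smooth_on_mult smooth_on_fst smooth_on_snd \<Psi>'(1) hs Ds)
    then show ?thesis
      by (rule smooth_on_cong[OF \<Psi>'(1), THEN iffD1, rotated])
        (simp add: pullback_def lorentz_field_expand[OF h \<Psi>'(4), symmetric])
  qed
  ultimately show ?thesis using \<Psi>'(1) by (simp add: lorentz_field_def)
qed

lemma pullback_compose:
  assumes "local_coordinates S z0 V z1 \<Psi>" "local_coordinates V z1 U z2 \<Phi>" "z \<in> U"
  shows "pullback (\<lambda>z. \<Psi> (\<Phi> z)) h z = pullback \<Phi> (pullback \<Psi> h) z"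
  using frechet_derivative_compose_smooth[OF local_coordinatesD(2)[OF assms(2)]
      local_coordinatesD(2)[OF assms(1)] assms(3) local_coordinatesD(4)[OF assms(2,3)]]
  by (simp add: pullback_def fun_eq_iff)

text \<open>\<open>\<Psi>\<close> is the flow map \<open>(x, y) \<mapsto> (x, \<phi> (x, y))\<close>
  moved to \<open>z0\<close>; it sends horizontal lines to integral curves of the direction field.
  As it keeps the first coordinate up to translation, vertical vectors remain vertical, which the
  last conclusion records for the second straightening.\<close>

lemma straighten_direction:
  fixes m :: "real \<times> real \<Rightarrow> real"
  assumes S: "open S" "z0 \<in> S" and m: "smooth_on S m"
  obtains V z1 \<Psi> where "local_coordinates S z0 V z1 \<Psi>"
    and "\<And>z. z \<in> V \<Longrightarrow> frechet_derivative \<Psi> (at z) (1, 0) = (1, m (\<Psi> z))"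
    and "\<And>z. z \<in> V \<Longrightarrow> fst (frechet_derivative \<Psi> (at z) (0, 1)) = 0"
proof -
  \<comment> \<open>The flow is constructed around the origin, so \<open>z0\<close> is moved
    there.\<close>
  define S' where "S' = (\<lambda>z. z0 + z) -` S"
  have S': "open S'" "0 \<in> S'"
    unfolding S'_def using S by (auto intro!: open_vimage continuous_intros)
  have "smooth_on S' (\<lambda>z. z0 + z)"
    by (intro smooth_on_add smooth_on_const smooth_on_ident S'(1))
  from smooth_on_compose[OF S'(1) S(1) _ this m]
  have "smooth_on S' (\<lambda>z. m (z0 + z))" by (auto simp: S'_def)
  from smooth_flow[OF S' this] obtain b \<phi> E where b: "b > 0"
    and \<phi>: "smooth_on ({-b<..<b} \<times> {-b<..<b}) \<phi>" "\<And>y. \<phi> (0, y) = y"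
      "\<And>z. z \<in> {-b<..<b} \<times> {-b<..<b} \<Longrightarrow> (fst z, \<phi> z) \<in> S'"
    and E: "\<And>z. E z > 0"
    and D: "\<And>z. z \<in> {-b<..<b} \<times> {-b<..<b} \<Longrightarrow>
      (\<phi> has_derivative (\<lambda>v. fst v * m (z0 + (fst z, \<phi> z)) + snd v * E z)) (at z)"
    by blast
  let ?I = "{-b<..<b}" and ?V = "{-b<..<b} \<times> {-b<..<b}"
  define \<Psi> where "\<Psi> z = z0 + (fst z, \<phi> z)" for z
  have V: "open ?V" by (intro open_Times) auto
  have D\<Psi>: "frechet_derivative \<Psi> (at z) = (\<lambda>v. (fst v, fst v * m (\<Psi> z) + snd v * E z))" if "z \<in> ?V" for z
  proof -
    have "((\<lambda>z. z0 + (fst z, \<phi> z)) has_derivative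
        (\<lambda>v. (fst v, fst v * m (z0 + (fst z, \<phi> z)) + snd v * E z))) (at z)"
      by (rule derivative_eq_intros D[OF that] refl)+ simp
    from frechet_derivative_at[OF this] show ?thesis by (simp add: \<Psi>_def[abs_def])
  qed
  have "inj_on \<Psi> ?V"
  proof (rule inj_onI)
    fix z w assume z: "z \<in> ?V" and w: "w \<in> ?V" and eq: "\<Psi> z = \<Psi> w"
    obtain x y y' where zw: "z = (x, y)" "w = (x, y')" and \<phi>: "\<phi> (x, y) = \<phi> (x, y')"
      using eq by (cases z, cases w) (auto simp: \<Psi>_def)
    \<comment> \<open>Positivity of \<open>E\<close>, the vertical derivative, makes
      \<open>\<phi>\<close> strictly increasing in \<open>y\<close>.\<close>
    have less: "\<phi> (x, u) < \<phi> (x, v)" if "u \<in> ?I" "v \<in> ?I" "u < v" for u v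
    proof (rule DERIV_pos_imp_increasing[OF that(3)])
      fix y assume "u \<le> y" "y \<le> v"
      then have "(x, y) \<in> ?V" using that z zw by auto
      from has_real_derivative_vertical[OF D[OF this]] E[of "(x, y)"]
      show "\<exists>d. ((\<lambda>y. \<phi> (x, y)) has_real_derivative d) (at y) \<and> 0 < d"
        by auto
    qed
    have "y = y'"
      using less[of y y'] less[of y' y] \<phi> z w zw by (cases y y' rule: linorder_cases) auto
    then show "z = w" using zw by simp
  qed
  moreover have "smooth_on ?V \<Psi>"
    unfolding \<Psi>_def
    by (intro smooth_on_add smooth_on_const smooth_on_Pair smooth_on_fst smooth_on_ident V \<phi>(1))
  moreover have "det2 (frechet_derivative \<Psi> (at z)) \<noteq> 0" if "z \<in> ?V" for z
    using D\<Psi>[OF that] E[of z] by (simp add: det2_def)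
  ultimately have "diffeomorphism ?V (\<Psi> ` ?V) \<Psi>"
    using V by (intro diffeomorphism_if_det2_nonzero) auto
  moreover have "\<Psi> ` ?V \<subseteq> S" using \<phi>(3) by (auto simp: \<Psi>_def S'_def)
  moreover have "\<Psi> (0, 0) = z0" using \<phi>(2)[of 0] by (simp add: \<Psi>_def prod_eq_iff)
  ultimately have "local_coordinates S z0 ?V (0, 0) \<Psi>"
    using b by (auto simp: local_coordinates_def)
  then show ?thesis using D\<Psi> by (intro that[of ?V "(0, 0)" \<Psi>]) auto
qed

text \<open>The last conclusion is conditional: the first use has no null vertical direction yet,
  and the second relies on it to keep the one already straightened. It holds because vertical
  vectors are mapped to vertical ones.\<close>

lemma straighten_null_direction:
  assumes h: "lorentz_field S h" and z0: "z0 \<in> S" and m: "smooth_on S m"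
    and null: "\<And>z. z \<in> S \<Longrightarrow> h z (1, m z) (1, m z) = 0"
  obtains V z1 \<Psi> where "local_coordinates S z0 V z1 \<Psi>"
    and "\<And>z. z \<in> V \<Longrightarrow> pullback \<Psi> h z (1, 0) (1, 0) = 0"
    and "\<And>z. z \<in> V \<Longrightarrow> h (\<Psi> z) (0, 1) (0, 1) = 0 \<Longrightarrow> pullback \<Psi> h z (0, 1) (0, 1) = 0"
proof -
  have S: "open S" using h by (simp add: lorentz_field_def)
  obtain V z1 \<Psi> where \<Psi>: "local_coordinates S z0 V z1 \<Psi>"
    and D1: "\<And>z. z \<in> V \<Longrightarrow> frechet_derivative \<Psi> (at z) (1, 0) = (1, m (\<Psi> z))"
    and D2: "\<And>z. z \<in> V \<Longrightarrow> fst (frechet_derivative \<Psi> (at z) (0, 1)) = 0"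
    using straighten_direction[OF S z0 m] by blast
  note \<Psi>' = local_coordinatesD[OF \<Psi>]
  show ?thesis
  proof (rule that[OF \<Psi>])
    show "pullback \<Psi> h z (1, 0) (1, 0) = 0" if "z \<in> V" for z
      using null[OF \<Psi>'(4)[OF that]] by (simp add: pullback_def D1 that)
    show "pullback \<Psi> h z (0, 1) (0, 1) = 0" if "z \<in> V" "h (\<Psi> z) (0, 1) (0, 1) = 0" for z
      using lorentz_field_expand[OF h \<Psi>'(4)[OF that(1)], of "frechet_derivative \<Psi> (at z) (0, 1)"
          "frechet_derivative \<Psi> (at z) (0, 1)"] that D2
      by (simp add: pullback_def)
  qed
qed


section \<open>Straightening both null directions and fixing the signs\<close>

lemma open_positive_locus:
  fixes f :: "'a::topological_space \<Rightarrow> real"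
  assumes "open S" "continuous_on S f"
  shows "open {z \<in> S. f z > 0}"
proof -
  have "open (S \<inter> f -` {0<..})"
    by (rule continuous_open_preimage[OF assms(2,1) open_greaterThan])
  moreover have "S \<inter> f -` {0<..} = {z \<in> S. f z > 0}" by auto
  ultimately show ?thesis by simp
qed

lemma lorentz_field_smooth: "lorentz_field S h \<Longrightarrow> smooth_on S (\<lambda>z. h z v w)"
  unfolding lorentz_field_def by blast

lemma lorentz_field_open: "lorentz_field S h \<Longrightarrow> open S"
  unfolding lorentz_field_def by blast

lemma lorentz_field_subset:
  "lorentz_field S h \<Longrightarrow> open T \<Longrightarrow> T \<subseteq> S \<Longrightarrow> lorentz_field T h"
  using smooth_on_subset unfolding lorentz_field_def by blast

text \<open>If the mixed component vanished too, the quadratic form would be a multiple of the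
  square of the first coordinate and could not take both values \<open>1\<close> and
  \<open>-1\<close>.\<close>

lemma null_field_mixed_nonzero:
  assumes h: "lorentz_field S h" and z: "z \<in> S" and null: "h z (0, 1) (0, 1) = 0"
  shows "h z (1, 0) (0, 1) \<noteq> 0"
proof
  assume F: "h z (1, 0) (0, 1) = 0"
  obtain e1 e2 where e: "h z e1 e1 = 1" "h z e2 e2 = -1"
    using h z unfolding lorentz_field_def by blast
  have E: "h z e e = fst e * fst e * h z (1, 0) (1, 0)" for e
    using lorentz_field_expand[OF h z, of e e] F null by simp
  have "h z (1, 0) (1, 0) > 0" "h z (1, 0) (1, 0) < 0"
    using E[of e1] E[of e2] e zero_le_square[of "fst e1"] zero_le_square[of "fst e2"]
    by (smt (verit) mult_nonneg_nonpos mult_nonneg_nonneg)+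
  then show False by simp
qed

text \<open>The Gram determinant of two vectors scales with the square of their determinant. For an
  orthonormal pair it equals \<open>-1\<close>, so such a pair is a basis.\<close>

lemma gram_determinant:
  assumes "lorentz_field S h" "z \<in> S"
  shows "h z u u * h z v v - (h z u v)\<^sup>2
    = (h z (1, 0) (1, 0) * h z (0, 1) (0, 1) - (h z (1, 0) (0, 1))\<^sup>2) * (fst u * snd v - fst v * snd u)\<^sup>2"
  unfolding lorentz_field_expand[OF assms, of u u] lorentz_field_expand[OF assms, of u v]
    lorentz_field_expand[OF assms, of v v] power2_eq_square
  by algebra

lemma pullback_linear:
  "linear L \<Longrightarrow> pullback L h z v w = h (L z) (L v) (L w)"
  by (simp add: pullback_def frechet_derivative_linear)

text \<open>The direction \<open>(1, m)\<close> is null when \<open>m\<close> is a root of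
  \<open>G m^2 + 2 F m + E\<close>. An orthonormal pair at \<open>z0\<close>, used as a linear
  change of coordinates, gives \<open>E = 1\<close> and \<open>G = -1\<close> there, so
  \<open>E > 0 > G\<close> nearby: the leading coefficient does not vanish and the discriminant is
  positive, hence the root is a smooth function.\<close>

lemma first_null_coordinate:
  assumes h: "lorentz_field S h" and z0: "z0 \<in> S"
  obtains V z1 \<Psi> where "local_coordinates S z0 V z1 \<Psi>"
    and "\<And>z. z \<in> V \<Longrightarrow> pullback \<Psi> h z (1, 0) (1, 0) = 0"
proof -
  obtain e1 e2 where e: "h z0 e1 e1 = 1" "h z0 e2 e2 = -1" "h z0 e1 e2 = 0"
    using h z0 unfolding lorentz_field_def by blast
  define L where "L v = fst v *\<^sub>R e1 + snd v *\<^sub>R e2" for v :: "real \<times> real"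
  have L: "linear L" "L (1, 0) = e1" "L (0, 1) = e2"
    by (auto simp: L_def intro!: linearI simp: algebra_simps)
  have "det2 L \<noteq> 0"
    using gram_determinant[OF h z0, of e1 e2] e by (auto simp: det2_def L)
  from local_coordinates_linear[OF lorentz_field_open[OF h] z0 L(1) this]
  obtain V1 z1 where c1: "local_coordinates S z0 V1 z1 L" by blast
  note c1' = local_coordinatesD[OF c1]
  define k where "k = pullback L h"
  have k: "lorentz_field V1 k" unfolding k_def by (rule lorentz_field_pullback[OF h c1])
  define E F G where "E z = k z (1, 0) (1, 0)" and "F z = k z (1, 0) (0, 1)"
    and "G z = k z (0, 1) (0, 1)" for z
  define T where "T = {z \<in> {z \<in> V1. E z > 0}. - G z > 0}"
  have smooth: "smooth_on V1 E" "smooth_on V1 F" "smooth_on V1 G"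
    unfolding E_def F_def G_def by (rule lorentz_field_smooth[OF k])+
  have "open {z \<in> V1. E z > 0}"
    by (rule open_positive_locus[OF c1'(1) smooth_on_imp_continuous_on[OF smooth(1)]])
  then have T: "open T"
    unfolding T_def
    by (rule open_positive_locus)
      (rule continuous_on_subset[of V1], use smooth_on_imp_continuous_on[OF smooth(3)] in \<open>auto intro!: continuous_intros\<close>)
  have TV: "T \<subseteq> V1" unfolding T_def by auto
  note sT = smooth[THEN smooth_on_subset[OF _ TV]]
  have z1: "z1 \<in> T"
    using e c1'(5,6) L by (simp add: T_def E_def G_def k_def pullback_linear)
  define m where "m z = (- F z - sqrt (F z * F z - E z * G z)) / G z" for z
  have disc: "F z * F z - E z * G z > 0" if "z \<in> T" for z
  proof -
    have "E z * G z < 0" using that by (intro mult_pos_neg) (auto simp: T_def)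
    then show ?thesis using zero_le_square[of "F z"] by linarith
  qed
  have m: "smooth_on T m"
    unfolding m_def
    by (intro smooth_on_divide smooth_on_diff smooth_on_minus smooth_on_sqrt smooth_on_mult T sT disc)
      (auto simp: T_def)
  have m_null: "k z (1, m z) (1, m z) = 0" if z: "z \<in> T" for z
  proof -
    have G: "G z \<noteq> 0" using z by (auto simp: T_def)
    define s where "s = sqrt (F z * F z - E z * G z)"
    have s: "s * s = F z * F z - E z * G z" using disc[OF z] by (simp add: s_def)
    have mG: "G z * m z = - F z - s" using G by (simp add: m_def s_def)
    have "k z (1, m z) (1, m z) = E z + 2 * m z * F z + m z * m z * G z"
      using lorentz_field_expand[OF k, of z "(1, m z)" "(1, m z)"] z TV by (auto simp: E_def F_def G_def)
    then have "G z * k z (1, m z) (1, m z) = G z * E z + 2 * (G z * m z) * F z + (G z * m z) * (G z * m z)"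
      by (simp add: algebra_simps)
    also have "\<dots> = 0" unfolding mG using s by (simp add: algebra_simps)
    finally show ?thesis using G by simp
  qed
  obtain V z2 \<Psi> where c2: "local_coordinates T z1 V z2 \<Psi>"
    and null: "\<And>z. z \<in> V \<Longrightarrow> pullback \<Psi> k z (1, 0) (1, 0) = 0"
    using straighten_null_direction[OF lorentz_field_subset[OF k T TV] z1 m m_null] by metis
  note c2' = local_coordinates_mono[OF c2 TV]
  show ?thesis
    by (rule that[OF local_coordinates_compose[OF c1 c2']])
      (use null in \<open>simp add: pullback_compose[OF c1 c2'] k_def\<close>)
qed

lemma linear_swap: "linear (prod.swap :: real \<times> real \<Rightarrow> real \<times> real)"
  by (auto intro!: linearI)

lemma det2_swap: "det2 prod.swap = -1"
  by (simp add: det2_def)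

text \<open>After the first straightening and a swap, the vertical direction is null and the
  quadratic equation for the other null direction \<open>(1, m)\<close> degenerates to
  \<open>E + 2 F m = 0\<close>. It is solvable because \<open>F\<close> cannot vanish when the
  vertical direction is null.\<close>

lemma both_null_coordinates:
  assumes h: "lorentz_field S h" and z0: "z0 \<in> S"
  obtains V z1 \<Psi> where "local_coordinates S z0 V z1 \<Psi>"
    and "\<And>z. z \<in> V \<Longrightarrow> pullback \<Psi> h z (1, 0) (1, 0) = 0"
    and "\<And>z. z \<in> V \<Longrightarrow> pullback \<Psi> h z (0, 1) (0, 1) = 0"
proof -
  obtain V1 z1 \<Psi>1 where c1: "local_coordinates S z0 V1 z1 \<Psi>1"
    and null1: "\<And>z. z \<in> V1 \<Longrightarrow> pullback \<Psi>1 h z (1, 0) (1, 0) = 0"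
    using first_null_coordinate[OF assms] by blast
  obtain V2 z2 where c2: "local_coordinates V1 z1 V2 z2 prod.swap"
    using local_coordinates_linear[OF local_coordinatesD(1,5)[OF c1] linear_swap] det2_swap by auto
  note c12 = local_coordinates_compose[OF c1 c2]
  define k where "k = pullback (\<lambda>z. \<Psi>1 (prod.swap z)) h"
  have k: "lorentz_field V2 k" unfolding k_def by (rule lorentz_field_pullback[OF h c12])
  have null2: "k z (0, 1) (0, 1) = 0" if "z \<in> V2" for z
    using null1[OF local_coordinatesD(4)[OF c2 that]]
    by (simp add: k_def pullback_compose[OF c1 c2 that] pullback_linear[OF linear_swap])
  define E F where "E z = k z (1, 0) (1, 0)" and "F z = k z (1, 0) (0, 1)" for z
  define m where "m z = - E z / (2 * F z)" for z
  have V2: "open V2" "z2 \<in> V2" using local_coordinatesD[OF c2] by auto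
  have F: "F z \<noteq> 0" if "z \<in> V2" for z
    unfolding F_def by (rule null_field_mixed_nonzero[OF k that null2[OF that]])
  have smooth: "smooth_on V2 E" "smooth_on V2 F"
    unfolding E_def F_def by (rule lorentz_field_smooth[OF k])+
  have m: "smooth_on V2 m"
    unfolding m_def
    by (intro smooth_on_divide smooth_on_minus smooth_on_mult smooth_on_const V2 smooth) (use F in auto)
  have m_null: "k z (1, m z) (1, m z) = 0" if "z \<in> V2" for z
    using lorentz_field_expand[OF k that, of "(1, m z)" "(1, m z)"] F[OF that] null2[OF that]
    by (simp add: m_def E_def F_def)
  obtain V z3 \<Psi> where c3: "local_coordinates V2 z2 V z3 \<Psi>"
    and null: "\<And>z. z \<in> V \<Longrightarrow> pullback \<Psi> k z (1, 0) (1, 0) = 0"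
      "\<And>z. z \<in> V \<Longrightarrow> k (\<Psi> z) (0, 1) (0, 1) = 0 \<Longrightarrow> pullback \<Psi> k z (0, 1) (0, 1) = 0"
    using straighten_null_direction[OF k V2(2) m m_null] by metis
  show ?thesis
    by (rule that[OF local_coordinates_compose[OF c12 c3]])
      (use null null2 local_coordinatesD(4)[OF c3] in \<open>simp_all add: pullback_compose[OF c12 c3] k_def\<close>)
qed

lemma det2_compose_linear:
  assumes "local_coordinates S z0 V z1 \<Psi>" "local_coordinates V z1 U z2 L" "linear L" "z \<in> U"
  shows "det2 (frechet_derivative (\<lambda>z. \<Psi> (L z)) (at z)) = det2 (frechet_derivative \<Psi> (at (L z))) * det2 L"
proof -
  have "L z \<in> V" by (rule local_coordinatesD(4)[OF assms(2,4)])
  have "frechet_derivative (\<lambda>z. \<Psi> (L z)) (at z) = (\<lambda>v. frechet_derivative \<Psi> (at (L z)) (L v))"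
    using frechet_derivative_compose_smooth[OF local_coordinatesD(2)[OF assms(2)]
        local_coordinatesD(2)[OF assms(1)] assms(4) \<open>L z \<in> V\<close>]
    by (simp add: frechet_derivative_linear[OF assms(3)] fun_eq_iff)
  then show ?thesis
    using det2_compose[OF has_derivative_linear[OF smooth_on_has_derivative[OF
          local_coordinatesD(2)[OF assms(1)] \<open>L z \<in> V\<close>]] assms(3)] by simp
qed

text \<open>Reflecting the first axis changes the sign of the mixed component and of the
  orientation; exchanging the axes reverses the orientation but leaves the mixed component alone, by
  symmetry. Hence the mixed component is corrected first and the orientation last. Both inequalities
  are arranged at the base point and hold nearby by continuity.\<close>

lemma oriented_null_coordinates:
  assumes h: "lorentz_field S h" and z0: "z0 \<in> S"
  obtains V z1 \<Psi> where "local_coordinates S z0 V z1 \<Psi>"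
    and "\<And>z. z \<in> V \<Longrightarrow> pullback \<Psi> h z (1, 0) (1, 0) = 0"
    and "\<And>z. z \<in> V \<Longrightarrow> pullback \<Psi> h z (0, 1) (0, 1) = 0"
    and "\<And>z. z \<in> V \<Longrightarrow> pullback \<Psi> h z (1, 0) (0, 1) > 0"
    and "\<And>z. z \<in> V \<Longrightarrow> det2 (frechet_derivative \<Psi> (at z)) > 0"
proof -
  obtain V1 z1 \<Psi>1 where c1: "local_coordinates S z0 V1 z1 \<Psi>1"
    and null1: "\<And>z. z \<in> V1 \<Longrightarrow> pullback \<Psi>1 h z (1, 0) (1, 0) = 0 \<and> pullback \<Psi>1 h z (0, 1) (0, 1) = 0"
    using both_null_coordinates[OF assms] by metis
  define k where "k = pullback \<Psi>1 h"
  have k: "lorentz_field V1 k" unfolding k_def by (rule lorentz_field_pullback[OF h c1])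
  note c1' = local_coordinatesD[OF c1]
  define \<sigma> where "\<sigma> = sgn (k z1 (1, 0) (0, 1))"
  have F1: "k z1 (1, 0) (0, 1) \<noteq> 0"
    using null_field_mixed_nonzero[OF k c1'(5)] null1[OF c1'(5)] by (simp add: k_def)
  define R where "R v = (\<sigma> * fst v, snd v)" for v :: "real \<times> real"
  have R: "linear R" "det2 R = \<sigma>"
    by (auto simp: R_def det2_def algebra_simps intro!: linearI)
  have "\<sigma> \<noteq> 0" using F1 by (simp add: \<sigma>_def sgn_zero_iff)
  then obtain V2 z2 where c2: "local_coordinates V1 z1 V2 z2 R"
    using local_coordinates_linear[OF c1'(1,5) R(1)] R(2) by auto
  define \<Psi>2 where "\<Psi>2 z = \<Psi>1 (R z)" for z
  have c12: "local_coordinates S z0 V2 z2 \<Psi>2"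
    unfolding \<Psi>2_def by (rule local_coordinates_compose[OF c1 c2])
  define k2 where "k2 = pullback \<Psi>2 h"
  have k2: "lorentz_field V2 k2" unfolding k2_def by (rule lorentz_field_pullback[OF h c12])
  have k2_eq: "k2 z v w = k (R z) (R v) (R w)" if "z \<in> V2" for z v w
    unfolding k2_def \<Psi>2_def[abs_def] pullback_compose[OF c1 c2 that] k_def
    by (rule pullback_linear[OF R(1)])
  have RV: "R z \<in> V1" if "z \<in> V2" for z by (rule local_coordinatesD(4)[OF c2 that])
  have null2: "k2 z (1, 0) (1, 0) = 0" "k2 z (0, 1) (0, 1) = 0" "k2 z (1, 0) (0, 1) = \<sigma> * k (R z) (1, 0) (0, 1)"
    if "z \<in> V2" for z
    using null1[OF RV[OF that]] lorentz_field_expand[OF k RV[OF that], of "(\<sigma>, 0)" "(\<sigma>, 0)"]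
      lorentz_field_expand[OF k RV[OF that], of "(\<sigma>, 0)" "(0, 1)"]
    by (simp_all add: k2_eq[OF that] R_def k_def)
  have F2: "k2 z2 (1, 0) (0, 1) > 0"
    using null2(3)[OF local_coordinatesD(5)[OF c2]] local_coordinatesD(6)[OF c2] F1
    by (simp add: \<sigma>_def mult.commute[of "sgn _"] flip: abs_sgn)
  define K :: "real \<times> real \<Rightarrow> real \<times> real"
    where "K = (if det2 (frechet_derivative \<Psi>2 (at z2)) > 0 then (\<lambda>v. v) else prod.swap)"
  have K: "linear K" "det2 K \<noteq> 0" "K = (\<lambda>v. v) \<or> K = prod.swap"
    using linear_swap det2_swap linear_id by (auto simp: K_def id_def)
  obtain V3 z3 where c3: "local_coordinates V2 z2 V3 z3 K"
    using local_coordinates_linear[OF local_coordinatesD(1,5)[OF c12] K(1,2)] by blast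
  define \<Psi> where "\<Psi> z = \<Psi>2 (K z)" for z
  have c: "local_coordinates S z0 V3 z3 \<Psi>"
    unfolding \<Psi>_def by (rule local_coordinates_compose[OF c12 c3])
  have pb: "pullback \<Psi> h z v w = k2 (K z) (K v) (K w)" if "z \<in> V3" for z v w
    unfolding \<Psi>_def[abs_def] pullback_compose[OF c12 c3 that] k2_def
    by (rule pullback_linear[OF K(1)])
  have KV: "K z \<in> V2" if "z \<in> V3" for z by (rule local_coordinatesD(4)[OF c3 that])
  have sym: "k2 z v w = k2 z w v" if "z \<in> V2" for z v w
    using k2 that unfolding lorentz_field_def by blast
  have null: "pullback \<Psi> h z (1, 0) (1, 0) = 0" "pullback \<Psi> h z (0, 1) (0, 1) = 0"
    "pullback \<Psi> h z (1, 0) (0, 1) = k2 (K z) (1, 0) (0, 1)" if "z \<in> V3" for z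
    using K(3) null2[OF KV[OF that]] sym[OF KV[OF that], of "(0, 1)" "(1, 0)"] by (auto simp: pb[OF that])
  have "det2 (frechet_derivative \<Psi>2 (at z2)) \<noteq> 0"
    using diffeomorphism_det2_nonzero[of V2 _ \<Psi>2 z2] c12 by (auto simp: local_coordinates_def)
  moreover have "det2 (frechet_derivative \<Psi> (at z3)) = det2 (frechet_derivative \<Psi>2 (at z2)) * det2 K"
    using det2_compose_linear[OF c12 c3 K(1) local_coordinatesD(5)[OF c3]] local_coordinatesD(6)[OF c3]
    by (simp add: \<Psi>_def[abs_def])
  ultimately have det: "det2 (frechet_derivative \<Psi> (at z3)) > 0"
    by (auto simp: K_def det2_swap)
  define d where "d z = det2 (frechet_derivative \<Psi> (at z))" for z
  define F where "F z = pullback \<Psi> h z (1, 0) (0, 1)" for z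
  note c' = local_coordinatesD[OF c]
  have "smooth_on V3 d"
    unfolding d_def det2_def
    by (intro smooth_on_diff smooth_on_mult smooth_on_fst smooth_on_snd smooth_on_frechet_derivative c')
  note cont_d = smooth_on_imp_continuous_on[OF this]
  have "smooth_on V3 F"
    unfolding F_def by (rule lorentz_field_smooth[OF lorentz_field_pullback[OF h c]])
  note cont_F = smooth_on_imp_continuous_on[OF this]
  define V where "V = {z \<in> {z \<in> V3. d z > 0}. F z > 0}"
  have "open {z \<in> V3. d z > 0}"
    by (rule open_positive_locus[OF c'(1) cont_d])
  then have V: "open V"
    unfolding V_def by (rule open_positive_locus) (rule continuous_on_subset[OF cont_F], auto)
  have "F z3 > 0"
    using F2 null(3)[OF c'(5)] local_coordinatesD(6)[OF c3] by (simp add: F_def)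
  then have "z3 \<in> V" using det c'(5) by (simp add: V_def d_def)
  have VV3: "V \<subseteq> V3" unfolding V_def by auto
  show ?thesis
  proof (rule that[OF local_coordinates_restrict[OF c V VV3 \<open>z3 \<in> V\<close>]])
    show "pullback \<Psi> h z (1, 0) (1, 0) = 0" "pullback \<Psi> h z (0, 1) (0, 1) = 0" if "z \<in> V" for z
      using null that VV3 by blast+
    show "pullback \<Psi> h z (1, 0) (0, 1) > 0" "det2 (frechet_derivative \<Psi> (at z)) > 0" if "z \<in> V" for z
      using that by (simp_all add: V_def F_def d_def)
  qed
qed


section \<open>Charts\<close>

lemma is_chartD:
  assumes "is_chart c"
  shows "open (fst c)" "open (snd c ` fst c)" "continuous_on (fst c) (snd c)"
    "continuous_on (snd c ` fst c) (inv_into (fst c) (snd c))" "inj_on (snd c) (fst c)"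
    "q \<in> fst c \<Longrightarrow> inv_into (fst c) (snd c) (snd c q) = q"
proof -
  show "open (fst c)" "open (snd c ` fst c)" "continuous_on (fst c) (snd c)"
    "continuous_on (snd c ` fst c) (inv_into (fst c) (snd c))"
    "q \<in> fst c \<Longrightarrow> inv_into (fst c) (snd c) (snd c q) = q"
    using assms unfolding is_chart_def homeomorphism_def by blast+
  show "inj_on (snd c) (fst c)"
    using assms unfolding is_chart_def homeomorphism_def inj_on_def by metis
qed

lemma in_chart_apply: "is_chart c \<Longrightarrow> q \<in> fst c \<Longrightarrow> in_chart c f (snd c q) = f q"
  by (simp add: in_chart_def is_chartD(6))

lemma open_chart_image:
  assumes c: "is_chart c" and U: "open U"
  shows "open (snd c ` (fst c \<inter> U))"
proof -
  have "snd c ` (fst c \<inter> U) = snd c ` fst c \<inter> inv_into (fst c) (snd c) -` U"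
    using is_chartD(6)[OF c] by auto
  also have "open \<dots>"
    by (rule continuous_open_preimage[OF is_chartD(4,2)[OF c] U])
  finally show ?thesis .
qed

lemma smooth_charts_is_chart: "c \<in> smooth_charts A \<Longrightarrow> is_chart c"
  by (simp add: smooth_charts_def)

lemma smooth_atlas_subset_smooth_charts: "smooth_atlas A \<Longrightarrow> A \<subseteq> smooth_charts A"
  by (auto simp: smooth_atlas_def smooth_charts_def)

lemma smooth_atlas_cover:
  assumes "smooth_atlas A"
  obtains d where "d \<in> A" "q \<in> fst d"
proof -
  have "q \<in> (\<Union>c\<in>A. fst c)" using assms by (simp add: smooth_atlas_def)
  then show ?thesis using that by blast
qed

lemma transition_self:
  "is_chart c \<Longrightarrow> q \<in> fst c \<Longrightarrow> q \<in> fst e \<Longrightarrow> transition c e (snd c q) = snd e q"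
  by (simp add: transition_def in_chart_apply)

text \<open>A chart of the maximal atlas is by definition compatible with the charts of
  \<open>A\<close>; the transition between two such charts is therefore factored near
  \<open>q\<close> through a chart of \<open>A\<close>.\<close>

lemma transition_has_derivative:
  assumes A: "smooth_atlas A" and c: "c \<in> smooth_charts A" "e \<in> smooth_charts A"
    and q: "q \<in> fst c" "q \<in> fst e"
  shows "(transition c e has_derivative transition_deriv c e q) (at (snd c q))"
proof -
  obtain d where d: "d \<in> A" "q \<in> fst d" using smooth_atlas_cover[OF A] .
  note ch = smooth_charts_is_chart[OF c(1)] smooth_charts_is_chart[OF c(2)]
  have chd: "is_chart d" using A d by (auto simp: smooth_atlas_def)
  have "smooth_on (snd c ` (fst c \<inter> fst d)) (transition c d)"
    "smooth_on (snd d ` (fst e \<inter> fst d)) (transition d e)"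
    using c d by (auto simp: smooth_charts_def compatible_def)
  then have D: "(transition c d has_derivative transition_deriv c d q) (at (snd c q))"
    "(transition d e has_derivative transition_deriv d e q) (at (snd d q))"
    unfolding transition_deriv_def using smooth_on_has_derivative q d by blast+
  have "transition c d (snd c q) = snd d q" by (rule transition_self[OF ch(1) q(1) d(2)])
  with diff_chain_at[OF D(1), of "transition d e"] D(2)
  have "(transition d e \<circ> transition c d has_derivative transition_deriv d e q \<circ> transition_deriv c d q) (at (snd c q))"
    by simp
  moreover have "open (snd c ` (fst c \<inter> (fst d \<inter> fst e)))"
    using open_chart_image[OF ch(1)] is_chartD(1)[OF chd] is_chartD(1)[OF ch(2)] by blast
  moreover have "(transition d e \<circ> transition c d) z = transition c e z"
    if "z \<in> snd c ` (fst c \<inter> (fst d \<inter> fst e))" for z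
    using that by (auto simp: transition_self ch chd)
  ultimately have "(transition c e has_derivative transition_deriv d e q \<circ> transition_deriv c d q) (at (snd c q))"
    using has_derivative_transform_within_open q d by blast
  then show ?thesis
    unfolding transition_deriv_def using frechet_derivative_at by metis
qed

lemma in_chart_change_has_derivative:
  assumes A: "smooth_atlas A" and c: "c \<in> smooth_charts A" "e \<in> smooth_charts A"
    and q: "q \<in> fst c" "q \<in> fst e"
    and f: "(in_chart e f has_derivative D) (at (snd e q))"
  shows "(in_chart c f has_derivative D \<circ> transition_deriv c e q) (at (snd c q))"
proof -
  note ch = smooth_charts_is_chart[OF c(1)] smooth_charts_is_chart[OF c(2)]
  have "transition c e (snd c q) = snd e q" by (rule transition_self[OF ch(1) q])
  with diff_chain_at[OF transition_has_derivative[OF A c q], of "in_chart e f"] f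
  have "(in_chart e f \<circ> transition c e has_derivative D \<circ> transition_deriv c e q) (at (snd c q))"
    by simp
  moreover have "open (snd c ` (fst c \<inter> fst e))"
    by (rule open_chart_image[OF ch(1) is_chartD(1)[OF ch(2)]])
  moreover have "(in_chart e f \<circ> transition c e) z = in_chart c f z" if "z \<in> snd c ` (fst c \<inter> fst e)" for z
    using that by (auto simp: transition_self in_chart_apply ch)
  ultimately show ?thesis
    using has_derivative_transform_within_open q by blast
qed

section \<open>Charts obtained by reparametrizing a given chart\<close>

definition reparametrize :: "'a chart \<Rightarrow> (real \<times> real) set \<Rightarrow> (real \<times> real \<Rightarrow> real \<times> real) \<Rightarrow> 'a chart" where
  "reparametrize d V \<Psi> = (fst d \<inter> snd d -` (\<Psi> ` V), \<lambda>q. inv_into V \<Psi> (snd d q))"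

locale reparametrized_chart =
  fixes d :: "'a::topological_space chart" and V :: "(real \<times> real) set" and \<Psi>
  assumes base_chart: "is_chart d" and diffeo: "diffeomorphism V (\<Psi> ` V) \<Psi>" and image_subset: "\<Psi> ` V \<subseteq> snd d ` fst d"
begin

abbreviation "c \<equiv> reparametrize d V \<Psi>"

lemma \<Psi>': "open V" "open (\<Psi> ` V)" "inj_on \<Psi> V" "smooth_on V \<Psi>" "smooth_on (\<Psi> ` V) (inv_into V \<Psi>)"
  using diffeo by (auto simp: diffeomorphism_def bij_betw_def)

lemma fst_subset: "fst c \<subseteq> fst d"
  by (auto simp: reparametrize_def)

lemma \<Psi>_snd: "q \<in> fst c \<Longrightarrow> snd c q \<in> V \<and> \<Psi> (snd c q) = snd d q"
  using \<Psi>'(3) by (auto simp: reparametrize_def)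

lemma inv_fst: 
  assumes "z \<in> V"
  shows "inv_into (fst d) (snd d) (\<Psi> z) \<in> fst c" "snd c (inv_into (fst d) (snd d) (\<Psi> z)) = z"
proof -
  have "\<Psi> z \<in> snd d ` fst d" using image_subset assms by auto
  then have "inv_into (fst d) (snd d) (\<Psi> z) \<in> fst d" "snd d (inv_into (fst d) (snd d) (\<Psi> z)) = \<Psi> z"
    by (auto intro: inv_into_into f_inv_into_f)
  then show "inv_into (fst d) (snd d) (\<Psi> z) \<in> fst c" "snd c (inv_into (fst d) (snd d) (\<Psi> z)) = z"
    using assms \<Psi>'(3) by (auto simp: reparametrize_def)
qed

lemma image: "snd c ` fst c = V"
proof
  show "snd c ` fst c \<subseteq> V" using \<Psi>_snd by blast
  show "V \<subseteq> snd c ` fst c"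
  proof
    fix z assume "z \<in> V"
    from inv_fst[OF this] show "z \<in> snd c ` fst c" by (metis imageI)
  qed
qed

lemma inj: "inj_on (snd c) (fst c)"
proof (rule inj_onI)
  fix q r assume q: "q \<in> fst c" "r \<in> fst c" "snd c q = snd c r"
  then have "snd d q = snd d r" using \<Psi>_snd by metis
  then show "q = r" using is_chartD(5)[OF base_chart] fst_subset q by (meson inj_onD subsetD)
qed

lemma inv: "z \<in> V \<Longrightarrow> inv_into (fst c) (snd c) z = inv_into (fst d) (snd d) (\<Psi> z)"
  using inv_into_f_f[OF inj inv_fst(1)] inv_fst(2) by metis

lemma is_chart: "is_chart c"
proof -
  have "open (fst d \<inter> snd d -` (\<Psi> ` V))"
    by (rule continuous_open_preimage[OF is_chartD(3,1)[OF base_chart] \<Psi>'(2)])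
  then have o: "open (fst c)" by (simp add: reparametrize_def)
  have "continuous_on (fst c) (\<lambda>q. inv_into V \<Psi> (snd d q))"
    by (rule continuous_on_compose2[OF smooth_on_imp_continuous_on[OF \<Psi>'(5)]
          continuous_on_subset[OF is_chartD(3)[OF base_chart] fst_subset]])
      (auto simp: reparametrize_def)
  then have cont: "continuous_on (fst c) (snd c)" by (simp add: reparametrize_def)
  have "continuous_on V (\<lambda>z. inv_into (fst d) (snd d) (\<Psi> z))"
    by (rule continuous_on_compose2[OF is_chartD(4)[OF base_chart] smooth_on_imp_continuous_on[OF \<Psi>'(4)] image_subset])
  then have cont_inv: "continuous_on V (inv_into (fst c) (snd c))"
    using inv by (simp cong: continuous_on_cong)
  show ?thesis
    unfolding is_chart_def homeomorphism_def image
  proof (intro conjI ballI o \<Psi>'(1) cont cont_inv refl)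
    show "inv_into (fst c) (snd c) (snd c q) = q" if "q \<in> fst c" for q
      using inj that by simp
    show "snd c (inv_into (fst c) (snd c) z) = z" if "z \<in> V" for z
      using that by (simp add: inv inv_fst)
    show "inv_into (fst c) (snd c) ` V = fst c"
      using inj image by (metis inv_into_image_cancel order_refl)
  qed
qed

lemma transition_from: "q \<in> fst c \<Longrightarrow> transition c e (snd c q) = transition d e (\<Psi> (snd c q))"
  using is_chartD(6)[OF base_chart] fst_subset \<Psi>_snd is_chartD(6)[OF is_chart]
  by (auto simp: transition_def in_chart_def)

lemma compatible:
  assumes e: "is_chart e" and de: "compatible d e"
  shows "compatible c e"
  unfolding compatible_def
proof
  let ?X = "snd c ` (fst c \<inter> fst e)"
  have oX: "open ?X" by (rule open_chart_image[OF is_chart is_chartD(1)[OF e]])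
  have oY: "open (snd d ` (fst d \<inter> fst e))" by (rule open_chart_image[OF base_chart is_chartD(1)[OF e]])
  have "smooth_on ?X (\<lambda>z. transition d e (\<Psi> z))"
  proof (rule smooth_on_compose[OF oX oY, where f = \<Psi> and g = "transition d e"])
    show "\<Psi> ` ?X \<subseteq> snd d ` (fst d \<inter> fst e)" using \<Psi>_snd fst_subset by fastforce
    show "smooth_on ?X \<Psi>" by (rule smooth_on_subset[OF \<Psi>'(4)]) (use image in auto)
    show "smooth_on (snd d ` (fst d \<inter> fst e)) (transition d e)" using de by (simp add: compatible_def)
  qed
  moreover have "transition c e z = transition d e (\<Psi> z)" if "z \<in> ?X" for z
    using that transition_from[of _ e] by blast
  ultimately show "smooth_on ?X (transition c e)"
    using smooth_on_cong[OF oX, of "transition c e" "\<lambda>z. transition d e (\<Psi> z)"] by blast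
  let ?Z = "snd e ` (fst c \<inter> fst e)"
  have oZ: "open ?Z"
    using open_chart_image[OF e is_chartD(1)[OF is_chart]] by (simp add: Int_commute)
  have "smooth_on ?Z (\<lambda>z. inv_into V \<Psi> (transition e d z))"
  proof (rule smooth_on_compose[OF oZ \<Psi>'(2), where f = "transition e d" and g = "inv_into V \<Psi>"])
    show "transition e d ` ?Z \<subseteq> \<Psi> ` V"
      using fst_subset by (auto simp: transition_self e reparametrize_def)
    show "smooth_on ?Z (transition e d)"
      by (rule smooth_on_subset[of "snd e ` (fst d \<inter> fst e)"])
        (use de fst_subset in \<open>auto simp: compatible_def\<close>)
    show "smooth_on (\<Psi> ` V) (inv_into V \<Psi>)" by (rule \<Psi>'(5))
  qed
  moreover have "transition e c z = inv_into V \<Psi> (transition e d z)" if "z \<in> ?Z" for z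
    using that fst_subset by (auto simp: transition_self e reparametrize_def)
  ultimately show "smooth_on ?Z (transition e c)"
    using smooth_on_cong[OF oZ, of "transition e c" "\<lambda>z. inv_into V \<Psi> (transition e d z)"] by blast
qed

lemma transition_deriv_from:
  assumes de: "compatible d e" and e: "is_chart e" and q: "q \<in> fst c" "q \<in> fst e"
  shows "transition_deriv c e q = (\<lambda>v. transition_deriv d e q (frechet_derivative \<Psi> (at (snd c q)) v))"
proof -
  have smooth: "smooth_on (snd d ` (fst d \<inter> fst e)) (transition d e)" using de by (simp add: compatible_def)
  have "q \<in> fst d" using q fst_subset by blast
  then have in_dom: "\<Psi> (snd c q) \<in> snd d ` (fst d \<inter> fst e)"
    using \<Psi>_snd[OF q(1)] q(2) by simp
  have eq: "transition c e z = transition d e (\<Psi> z)" if "z \<in> V" for z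
  proof -
    have "z \<in> snd c ` fst c" unfolding image by (rule that)
    then obtain r where "r \<in> fst c" "z = snd c r" by (rule imageE) simp
    then show ?thesis using transition_from[of r e] by simp
  qed
  have "frechet_derivative (transition c e) (at (snd c q))
      = frechet_derivative (\<lambda>z. transition d e (\<Psi> z)) (at (snd c q))"
    using \<Psi>_snd[OF q(1)] by (intro frechet_derivative_cong_open[OF \<Psi>'(1) _ eq]) auto
  then show ?thesis
    using frechet_derivative_compose_smooth[OF \<Psi>'(4) smooth _ in_dom] \<Psi>_snd[OF q(1)]
    by (simp add: transition_deriv_def fun_eq_iff)
qed

lemma transition_deriv_base:
  assumes "q \<in> fst c"
  shows "transition_deriv c d q = frechet_derivative \<Psi> (at (snd c q))"
proof -
  have "transition c d z = \<Psi> z" if "z \<in> V" for z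
    using that image_subset by (auto simp: transition_def in_chart_def inv f_inv_into_f image_subset_iff)
  then show ?thesis
    unfolding transition_deriv_def
    using \<Psi>_snd[OF assms] by (intro frechet_derivative_cong_open[OF \<Psi>'(1)]) auto
qed

end

text \<open>The components of \<open>g\<close> in a chart \<open>d\<close> of \<open>A\<close> form
  a \<open>lorentz_field\<close>, and its oriented null coordinates reparametrize \<open>d\<close>.
  The transformation law of the metric identifies \<open>g\<close> in the new chart with the
  pullback; the orientation relative to each chart of \<open>A\<close> follows by multiplying
  Jacobian determinants, since the atlas is oriented.\<close>

lemma proper_null_coordinates_exist:
  fixes A :: "'a::topological_space chart set"
  assumes S: "lorentz_surface A g"
  obtains c where "proper_null_coordinates A g c" "p \<in> fst c"
proof -
  have A: "smooth_atlas A" and orient: "\<And>d e. d \<in> A \<Longrightarrow> e \<in> A \<Longrightarrow> same_orientation d e"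
    and g: "lorentz_metric A g"
    using S by (auto simp: lorentz_surface_def oriented_atlas_def)
  obtain d where d: "d \<in> A" "p \<in> fst d" using smooth_atlas_cover[OF A] .
  have ch: "is_chart d" using A d by (auto simp: smooth_atlas_def)
  have dS: "d \<in> smooth_charts A" using d smooth_atlas_subset_smooth_charts[OF A] by auto
  define h where "h z v w = in_chart d (\<lambda>q. g d q v w) z" for z v w
  have h_snd: "h (snd d q) v w = g d q v w" if "q \<in> fst d" for q v w
    unfolding h_def by (rule in_chart_apply[OF ch that])
  have "lorentz_field (snd d ` fst d) h"
    unfolding lorentz_field_def
  proof (intro conjI ballI allI)
    show "open (snd d ` fst d)" by (rule is_chartD(2)[OF ch])
    show "smooth_on (snd d ` fst d) (\<lambda>z. h z v w)" for v w
      using g dS unfolding lorentz_metric_def h_def by blast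
    fix z assume "z \<in> snd d ` fst d"
    then obtain q where q: "q \<in> fst d" "z = snd d q" by blast
    have "h z = g d q" using h_snd[OF q(1)] q(2) by (simp add: fun_eq_iff)
    then show "bilinear (h z)" "h z v w = h z w v"
      "\<exists>e1 e2. h z e1 e1 = 1 \<and> h z e2 e2 = - 1 \<and> h z e1 e2 = 0" for v w
      using g dS q(1) unfolding lorentz_metric_def by metis+
  qed
  then obtain V z1 \<Psi> where \<Psi>: "local_coordinates (snd d ` fst d) (snd d p) V z1 \<Psi>"
    and null: "\<And>z. z \<in> V \<Longrightarrow> pullback \<Psi> h z (1, 0) (1, 0) = 0"
      "\<And>z. z \<in> V \<Longrightarrow> pullback \<Psi> h z (0, 1) (0, 1) = 0"
      "\<And>z. z \<in> V \<Longrightarrow> pullback \<Psi> h z (1, 0) (0, 1) > 0"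
      "\<And>z. z \<in> V \<Longrightarrow> det2 (frechet_derivative \<Psi> (at z)) > 0"
    using oriented_null_coordinates[of "snd d ` fst d" h "snd d p"] d(2) by blast
  interpret reparametrized_chart d V \<Psi>
    using \<Psi> ch by unfold_locales (auto simp: local_coordinates_def)
  have compat: "compatible d e" "is_chart e" if "e \<in> A" for e
    using A d(1) that unfolding smooth_atlas_def by blast+
  have c: "c \<in> smooth_charts A"
    using is_chart compatible compat by (auto simp: smooth_charts_def)
  have gc: "g c q v w = pullback \<Psi> h (snd c q) v w" if q: "q \<in> fst c" for q v w
  proof -
    have qd: "q \<in> fst d" using q fst_subset by auto
    have "g c q v w = g d q (transition_deriv c d q v) (transition_deriv c d q w)"
      using g c dS q qd unfolding lorentz_metric_def by blast
    then show ?thesis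
      using h_snd[OF qd] \<Psi>_snd[OF q] by (simp add: transition_deriv_base[OF q] pullback_def)
  qed
  have "same_orientation c e" if e: "e \<in> A" for e
    unfolding same_orientation_def
  proof
    fix q assume q: "q \<in> fst c \<inter> fst e"
    then have qc: "q \<in> fst c" "q \<in> fst e" and qd: "q \<in> fst d" using fst_subset by auto
    have eS: "e \<in> smooth_charts A" using e smooth_atlas_subset_smooth_charts[OF A] by auto
    have "det2 (transition_deriv c e q) = det2 (transition_deriv d e q) * det2 (frechet_derivative \<Psi> (at (snd c q)))"
      unfolding transition_deriv_from[OF compat[OF e] qc]
      using det2_compose[OF has_derivative_linear[OF transition_has_derivative[OF A dS eS qd qc(2)]]
          has_derivative_linear[OF smooth_on_has_derivative[OF \<Psi>'(4)]]] \<Psi>_snd[OF qc(1)] by blast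
    moreover have "det2 (transition_deriv d e q) > 0"
      using orient[OF d(1) e] qd qc(2) by (simp add: same_orientation_def)
    ultimately show "det2 (transition_deriv c e q) > 0"
      using null(4) \<Psi>_snd[OF qc(1)] by simp
  qed
  then have "proper_null_coordinates A g c"
    using c gc null \<Psi>_snd unfolding proper_null_coordinates_def null_coordinates_def by simp
  moreover have "snd d p \<in> \<Psi> ` V"
    using local_coordinatesD(5,6)[OF \<Psi>] by (metis imageI)
  then have "p \<in> fst c"
    using d(2) by (simp add: reparametrize_def)
  ultimately show ?thesis by (rule that)
qed


section \<open>Pseudospherical surfaces have no \<open>D\<^sub>4\<close>-singularities\<close>

lemma pdx_eq_derivative:
  assumes "(h has_derivative D) (at z)"
  shows "pdx h z = D (1, 0)"
proof -
  have "((\<lambda>x. (x, snd z)) has_derivative (\<lambda>t. (t, 0))) (at (fst z))"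
    by (auto intro!: derivative_eq_intros)
  from diff_chain_at[OF this, of h D] assms
  have "((\<lambda>x. h (x, snd z)) has_derivative (\<lambda>t. D (t, 0))) (at (fst z))"
    by (simp add: o_def)
  moreover have "(\<lambda>t. D (t, 0)) = (\<lambda>t. t *\<^sub>R D (1, 0))"
  proof
    fix t :: real
    show "D (t, 0) = t *\<^sub>R D (1, 0)"
      using linear_cmul[OF has_derivative_linear[OF assms], of t "(1, 0)"] by simp
  qed
  ultimately show ?thesis
    unfolding pdx_def by (intro vector_derivative_at) (simp only: has_vector_derivative_def)
qed

lemma pdy_eq_derivative:
  assumes "(h has_derivative D) (at z)"
  shows "pdy h z = D (0, 1)"
proof -
  have "((\<lambda>y. (fst z, y)) has_derivative (\<lambda>t. (0, t))) (at (snd z))"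
    by (auto intro!: derivative_eq_intros)
  from diff_chain_at[OF this, of h D] assms
  have "((\<lambda>y. h (fst z, y)) has_derivative (\<lambda>t. D (0, t))) (at (snd z))"
    by (simp add: o_def)
  moreover have "(\<lambda>t. D (0, t)) = (\<lambda>t. t *\<^sub>R D (0, 1))"
  proof
    fix t :: real
    show "D (0, t) = t *\<^sub>R D (0, 1)"
      using linear_cmul[OF has_derivative_linear[OF assms], of t "(0, 1)"] by simp
  qed
  ultimately show ?thesis
    unfolding pdy_def by (intro vector_derivative_at) (simp only: has_vector_derivative_def)
qed

lemma derivative_orthogonal_if_norm_1:
  fixes N :: "'a::real_normed_vector \<Rightarrow> 'b::real_inner"
  assumes "(N has_derivative D) (at z)" "open S" "z \<in> S" "\<And>w. w \<in> S \<Longrightarrow> norm (N w) = 1"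
  shows "N z \<bullet> D v = 0"
proof -
  have "((\<lambda>w. N w \<bullet> N w) has_derivative (\<lambda>v. N z \<bullet> D v + D v \<bullet> N z)) (at z)"
    using has_derivative_inner[OF assms(1,1)] .
  moreover have "((\<lambda>w. N w \<bullet> N w) has_derivative (\<lambda>v. 0)) (at z)"
    by (rule has_derivative_transform_within_open[OF has_derivative_const[of 1] assms(2,3)])
      (simp add: dot_square_norm assms(4))
  ultimately have "(\<lambda>v. N z \<bullet> D v + D v \<bullet> N z) = (\<lambda>v. 0)"
    by (rule has_derivative_unique)
  then have "N z \<bullet> D v + D v \<bullet> N z = 0" by metis
  then show ?thesis by (simp add: inner_commute)
qed

lemma lorentzian_harmonic_norm:
  assumes "lorentzian_harmonic A g N"
  shows "norm (N q) = 1"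
proof -
  have "N q \<in> sphere 0 1" using assms unfolding lorentzian_harmonic_def by blast
  then show ?thesis by simp
qed

text \<open>In a proper null chart the partial derivatives of \<open>f\<close> are cross products
  with \<open>N\<close>, hence orthogonal to it. If they vanish, those of \<open>N\<close> are
  parallel to \<open>N\<close>; being also orthogonal to it, because \<open>N\<close> has norm one,
  they are zero. Both conclusions pass to the chart \<open>e\<close> by the chain rule.\<close>

lemma pseudospherical_derivatives:
  assumes S: "lorentz_surface A g" and N: "lorentzian_harmonic A g N"
    and f: "pseudospherical_surface A g N f"
    and e: "e \<in> smooth_charts A" "q \<in> fst e"
    and DF: "(in_chart e f has_derivative DF) (at (snd e q))"
    and DN: "(in_chart e N has_derivative DN) (at (snd e q))"
  shows "N q \<bullet> DF v = 0" and "(\<And>v. DF v = 0) \<Longrightarrow> DN v = 0"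
proof -
  have A: "smooth_atlas A" using S by (simp add: lorentz_surface_def oriented_atlas_def)
  obtain c where c: "proper_null_coordinates A g c" "q \<in> fst c"
    using proper_null_coordinates_exist[OF S] .
  then have cS: "c \<in> smooth_charts A"
    by (simp add: proper_null_coordinates_def null_coordinates_def)
  note ch = smooth_charts_is_chart[OF cS]
  let ?z = "snd c q"
  define T T' where "T = transition_deriv c e q" and "T' = transition_deriv e c q"
  note DcF = in_chart_change_has_derivative[OF A cS e(1) c(2) e(2) DF, folded T_def]
  note DcN = in_chart_change_has_derivative[OF A cS e(1) c(2) e(2) DN, folded T_def]
  have z: "?z \<in> snd c ` fst c" using c(2) by simp
  have Nq: "in_chart c N ?z = N q" by (rule in_chart_apply[OF ch c(2)])
  have unit: "norm (N r) = 1" for r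
    by (rule lorentzian_harmonic_norm[OF N])
  then have "norm (in_chart c N w) = 1" for w
    by (simp add: in_chart_def)
  from derivative_orthogonal_if_norm_1[OF DcN open_UNIV UNIV_I this]
  have orth: "N q \<bullet> (DN \<circ> T) v = 0" for v using Nq by simp
  have "pdx (in_chart c f) ?z = cross3 (in_chart c N ?z) (pdx (in_chart c N) ?z)"
    "pdy (in_chart c f) ?z = - cross3 (in_chart c N ?z) (pdy (in_chart c N) ?z)"
    using f c(1) z unfolding pseudospherical_surface_def by blast+
  then have Fx: "(DF \<circ> T) (1, 0) = cross3 (N q) ((DN \<circ> T) (1, 0))"
    and Fy: "(DF \<circ> T) (0, 1) = - cross3 (N q) ((DN \<circ> T) (0, 1))"
    by (simp_all only: pdx_eq_derivative[OF DcF] pdx_eq_derivative[OF DcN]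
        pdy_eq_derivative[OF DcF] pdy_eq_derivative[OF DcN] Nq)
  have linF: "linear (DF \<circ> T)" and linN: "linear (DN \<circ> T)"
    using DcF DcN has_derivative_linear by blast+
  \<comment> \<open>Changing charts from \<open>e\<close> to \<open>c\<close> and back reproduces
    the derivative in \<open>e\<close> by uniqueness; this replaces a proof that \<open>T\<close>
    and \<open>T'\<close> are mutually inverse.\<close>
  have inverse_change: "DF = (DF \<circ> T) \<circ> T'" "DN = (DN \<circ> T) \<circ> T'"
    using has_derivative_unique[OF DF in_chart_change_has_derivative[OF A e(1) cS e(2) c(2) DcF]]
      has_derivative_unique[OF DN in_chart_change_has_derivative[OF A e(1) cS e(2) c(2) DcN]]
    by (simp_all only: T'_def)
  have "N q \<bullet> (DF \<circ> T) u = 0" for u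
    unfolding linear_prod_real[OF linF, of u] Fx Fy by (simp add: inner_add_right inner_diff_right dot_cross_self)
  then show "N q \<bullet> DF v = 0" by (subst inverse_change(1)) simp
  assume "\<And>v. DF v = 0"
  then have "cross3 (N q) ((DN \<circ> T) (1, 0)) = 0" "cross3 (N q) ((DN \<circ> T) (0, 1)) = 0"
    using Fx Fy by auto
  moreover have "N q \<noteq> 0" using unit[of q] by auto
  ultimately have "(DN \<circ> T) (1, 0) = 0" "(DN \<circ> T) (0, 1) = 0"
    using orth norm_and_cross_eq_0 by blast+
  then have "(DN \<circ> T) u = 0" for u
    using linear_prod_real[OF linN, of u] by simp
  then show "DN v = 0" by (subst inverse_change(2)) simp
qed

section \<open>The normal form along its axis\<close>

lemma D4_model_has_derivative:
  "(D4_model sg has_derivative (\<lambda>v. vector [fst z * snd v + fst v * snd z,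
      2 * fst z * fst v - sg * 6 * snd z * snd v,
      2 * fst z * fst v * snd z + (fst z)\<^sup>2 * snd v - sg * 3 * (snd z)\<^sup>2 * snd v])) (at z)"
proof -
  \<comment> \<open>Over the basis vectors the map is differentiated by the rules for real
    polynomials.\<close>
  have eq: "D4_model sg z = (fst z * snd z) *\<^sub>R axis 1 1 + ((fst z)\<^sup>2 - sg * 3 * (snd z)\<^sup>2) *\<^sub>R axis 2 1
      + ((fst z)\<^sup>2 * snd z - sg * (snd z)^3) *\<^sub>R axis 3 1" for z :: "real \<times> real"
    by (simp add: D4_model_def split_beta vec_eq_iff forall_3 vector_3 axis_def)
  show ?thesis
    unfolding eq[abs_def]
    by (rule derivative_eq_intros refl | simp)+
      (simp add: fun_eq_iff vec_eq_iff forall_3 vector_3 axis_def algebra_simps power2_eq_square)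
qed

text \<open>On the axis the columns of the derivative of the normal form are
  \<open>(0, 2 s, 0)\<close> and \<open>(s, 0, s^2)\<close>, free of \<open>sg\<close>, so both
  signs are treated at once. At the origin the columns vanish and orthogonality says nothing; the
  relations are divided by \<open>s\<close> elsewhere and passed to the limit.\<close>

lemma no_D4_along_axis:
  fixes \<Theta> :: "real^3 \<Rightarrow> real^3" and M :: "real \<times> real \<Rightarrow> real^3"
  assumes X: "open X" "(0, 0) \<in> X" and W: "open W" and \<Theta>: "smooth_on W \<Theta>"
    and XW: "\<And>z. z \<in> X \<Longrightarrow> D4_model sg z \<in> W"
    and M: "\<And>z. z \<in> X \<Longrightarrow> (M has_derivative DM z) (at z)" and M0: "\<And>v. DM (0, 0) v = 0"
    and orth: "\<And>z v. z \<in> X \<Longrightarrow>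
      M z \<bullet> frechet_derivative \<Theta> (at (D4_model sg z)) (frechet_derivative (D4_model sg) (at z) v) = 0"
  shows "M (0, 0) \<bullet> frechet_derivative \<Theta> (at 0) w = 0"
proof -
  define a where "a y i = frechet_derivative \<Theta> (at y) (axis i 1)" for y :: "real^3" and i :: 3
  define y where "y s = D4_model sg (s, 0)" for s
  have y0: "y 0 = 0" by (simp add: y_def D4_model_def vec_eq_iff forall_3 vector_3)
  define n where "n i s = M (s, 0) \<bullet> a (y s) i" for i s
  define D :: "real \<times> real \<Rightarrow> real \<times> real \<Rightarrow> real^3" where "D z v = vector [fst z * snd v + fst v * snd z,
      2 * fst z * fst v - sg * 6 * snd z * snd v,
      2 * fst z * fst v * snd z + (fst z)\<^sup>2 * snd v - sg * 3 * (snd z)\<^sup>2 * snd v]" for z v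
  have DD: "(D4_model sg has_derivative D z) (at z)" for z
    unfolding D_def by (rule D4_model_has_derivative)
  then have fD: "frechet_derivative (D4_model sg) (at z) = D z" for z
    using frechet_derivative_at by metis
  define I where "I = (\<lambda>s. (s, 0)) -` X"
  have I: "open I" "0 \<in> I"
    unfolding I_def using X by (auto intro!: open_vimage continuous_intros)
  have lin: "linear (frechet_derivative \<Theta> (at (y s)))" if "s \<in> I" for s
    using smooth_on_has_derivative[OF \<Theta> XW[of "(s, 0)"]] has_derivative_linear that
    by (auto simp: I_def y_def)
  have line: "((\<lambda>s::real. (s, 0::real)) has_derivative (\<lambda>t. (t, 0))) (at s)" for s
    by (auto intro!: derivative_eq_intros)
  have dn: "(n i has_derivative (\<lambda>t. M (s, 0) \<bullet> frechet_derivative (\<lambda>y. a y i) (at (y s)) (D (s, 0) (t, 0))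
      + DM (s, 0) (t, 0) \<bullet> a (y s) i)) (at s)" if "s \<in> I" for i s
  proof -
    have "smooth_on W (\<lambda>y. a y i)"
      unfolding a_def by (rule smooth_on_frechet_derivative[OF \<Theta>])
    moreover have "y s \<in> W" using XW[of "(s, 0)"] that by (simp add: I_def y_def)
    ultimately have Da: "((\<lambda>y. a y i) has_derivative frechet_derivative (\<lambda>y. a y i) (at (y s))) (at (y s))"
      by (rule smooth_on_has_derivative)
    have "(y has_derivative (\<lambda>t. D (s, 0) (t, 0))) (at s)"
      using diff_chain_at[OF line DD] by (simp add: o_def y_def[abs_def])
    from diff_chain_at[OF this Da]
    have "((\<lambda>s. a (y s) i) has_derivative (\<lambda>t. frechet_derivative (\<lambda>y. a y i) (at (y s)) (D (s, 0) (t, 0)))) (at s)"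
      by (simp add: o_def)
    moreover have "((\<lambda>s. M (s, 0)) has_derivative (\<lambda>t. DM (s, 0) (t, 0))) (at s)"
      using diff_chain_at[OF line M] that by (simp add: o_def I_def)
    ultimately show ?thesis
      unfolding n_def[abs_def] by (intro has_derivative_inner)
  qed
  have cont: "isCont (n i) 0" for i
    using dn[OF I(2)] has_derivative_continuous by blast
  have rel: "n 2 s = 0 \<and> n 1 s + s * n 3 s = 0" if s: "s \<in> I" "s \<noteq> 0" for s
  proof -
    have X: "(s, 0) \<in> X" using s by (simp add: I_def)
    have "D (s, 0) (1, 0) = (2 * s) *\<^sub>R axis 2 1" "D (s, 0) (0, 1) = s *\<^sub>R (axis 1 1 + s *\<^sub>R axis 3 1)"
      by (simp_all add: D_def vec_eq_iff forall_3 vector_3 axis_def power2_eq_square)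
    with orth[OF X, of "(1, 0)"] orth[OF X, of "(0, 1)"]
    have "2 * s * n 2 s = 0" "s * (n 1 s + s * n 3 s) = 0"
      using lin[OF s(1)]
      by (simp_all add: fD n_def a_def y_def linear_cmul linear_add inner_add_right)
    then show ?thesis using s by simp
  qed
  have eventually_rel: "\<forall>\<^sub>F s in at 0. n 2 s = 0 \<and> n 1 s + s * n 3 s = 0"
    using eventually_at_in_open[OF I] rel by (auto elim!: eventually_mono)
  have zero_limit: "k 0 = 0" if "isCont k 0" "\<forall>\<^sub>F s in at 0. k s = 0" for k :: "real \<Rightarrow> real"
  proof -
    have "(k \<longlongrightarrow> k 0) (at 0)" using that(1) by (simp add: isCont_def)
    moreover have "(k \<longlongrightarrow> 0) (at 0)" using that(2) by (rule tendsto_eventually)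
    ultimately show ?thesis by (rule LIM_unique)
  qed
  have n2: "n 2 0 = 0"
    by (rule zero_limit[OF cont]) (use eventually_rel in \<open>rule eventually_mono, blast\<close>)
  have "isCont (\<lambda>s. n 1 s + s * n 3 s) 0"
    by (intro continuous_intros cont)
  moreover have "\<forall>\<^sub>F s in at 0. n 1 s + s * n 3 s = 0"
    using eventually_rel by (rule eventually_mono) blast
  ultimately have "n 1 0 + 0 * n 3 0 = 0" by (rule zero_limit)
  then have n1: "n 1 0 = 0" by simp
  \<comment> \<open>Both summands in the derivative of \<open>n 1\<close> at \<open>0\<close>
    vanish: one through the derivative of the normal form, the other through
    \<open>M0\<close>.\<close>
  have "D (0, 0) v = 0" for v
    by (simp add: D_def vec_eq_iff forall_3 vector_3)
  moreover have "linear (frechet_derivative (\<lambda>y. a y 1) (at 0))"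
  proof -
    have "smooth_on W (\<lambda>y. a y 1)" unfolding a_def by (rule smooth_on_frechet_derivative[OF \<Theta>])
    moreover have "0 \<in> W" using XW[OF X(2)] y0 by (simp add: y_def)
    ultimately show ?thesis using smooth_on_has_derivative has_derivative_linear by blast
  qed
  note linear_0[OF this]
  ultimately have "(n 1 has_derivative (\<lambda>t. 0)) (at 0)"
    using dn[OF I(2), of 1] by (simp add: M0 y0)
  moreover have "(\<lambda>t. 0) = (*) (0::real)" by auto
  ultimately have "(n 1 has_field_derivative 0) (at 0)"
    by (simp only: has_field_derivative_def)
  then have dn1: "((\<lambda>s. n 1 s / s) \<longlongrightarrow> 0) (at 0)"
    using n1 by (simp add: has_field_derivative_iff)
  \<comment> \<open>The difference quotient of \<open>n 1\<close> at \<open>0\<close> equals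
    \<open>- n 3 s\<close>, so the vanishing derivative of \<open>n 1\<close> determines
    \<open>n 3 0\<close>.\<close>
  have "\<forall>\<^sub>F s in at (0::real). n 1 s / s = - n 3 s"
    using eventually_rel eventually_neq_at_within[of 0]
    by eventually_elim (auto simp: field_simps)
  from Lim_transform_eventually[OF dn1 this]
  have "((\<lambda>s. - n 3 s) \<longlongrightarrow> 0) (at 0)" .
  moreover have "((\<lambda>s. - n 3 s) \<longlongrightarrow> - n 3 0) (at 0)"
    using cont[of 3] by (intro tendsto_minus) (simp add: isCont_def)
  ultimately have "- n 3 0 = 0" by (rule LIM_unique[rotated])
  then have n3: "n 3 0 = 0" by simp
  let ?L = "frechet_derivative \<Theta> (at 0)"
  have L: "linear ?L" using lin[OF I(2)] by (simp only: y0)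
  have "w = w $ 1 *\<^sub>R axis 1 1 + w $ 2 *\<^sub>R axis 2 1 + w $ 3 *\<^sub>R axis 3 1"
    by (simp add: vec_eq_iff forall_3 axis_def)
  then have "?L w = ?L (w $ 1 *\<^sub>R axis 1 1 + w $ 2 *\<^sub>R axis 2 1 + w $ 3 *\<^sub>R axis 3 1)"
    by (rule arg_cong)
  also have "\<dots> = w $ 1 *\<^sub>R a (y 0) 1 + w $ 2 *\<^sub>R a (y 0) 2 + w $ 3 *\<^sub>R a (y 0) 3"
    by (simp only: linear_add[OF L] linear_cmul[OF L] a_def y0)
  finally have "M (0, 0) \<bullet> ?L w = w $ 1 * n 1 0 + w $ 2 * n 2 0 + w $ 3 * n 3 0"
    by (simp only: n_def inner_add_right inner_scaleR_right)
  then show ?thesis by (simp add: n1 n2 n3)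
qed

text \<open>The argument is uniform in the real parameter \<open>sg\<close> and treats fronts and
  other frontals alike.\<close>

lemma pseudospherical_surface_no_D4:
  assumes S: "lorentz_surface A g" and N: "lorentzian_harmonic A g N"
    and f: "pseudospherical_surface A g N f"
  shows "\<not> D4_singularity A sg f p"
proof
  assume "D4_singularity A sg f p"
  then obtain e V W \<Phi> where e: "e \<in> smooth_charts A" "p \<in> fst e" "snd e p = (0, 0)"
    and \<Phi>: "diffeomorphism V W \<Phi>" and fV: "f p \<in> V" "\<Phi> (f p) = 0" "f ` fst e \<subseteq> V"
    and \<Phi>f: "\<And>q. q \<in> fst e \<Longrightarrow> \<Phi> (f q) = D4_model sg (snd e q)"
    unfolding D4_singularity_def by blast
  note ch = smooth_charts_is_chart[OF e(1)]
  define \<Theta> where "\<Theta> = inv_into V \<Phi>"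
  let ?X = "snd e ` fst e" and ?F = "in_chart e f" and ?M = "in_chart e N"
  have X: "open ?X" "(0, 0) \<in> ?X" using is_chartD(2)[OF ch] e by (auto simp flip: e(3))
  have W: "open W" "smooth_on W \<Theta>" "inj_on \<Phi> V" "\<Phi> ` V = W"
    using \<Phi> by (auto simp: diffeomorphism_def bij_betw_def \<Theta>_def)
  have XW: "D4_model sg z \<in> W" if "z \<in> ?X" for z
    using that \<Phi>f fV(3) W(4) by (auto simp flip: \<Phi>f)
  have F: "?F z = \<Theta> (D4_model sg z)" if z: "z \<in> ?X" for z
  proof -
    obtain q where q: "q \<in> fst e" "z = snd e q" using z by blast
    have "\<Theta> (\<Phi> (f q)) = f q" unfolding \<Theta>_def using W(3) fV(3) q by (intro inv_into_f_f) auto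
    then show ?thesis using q \<Phi>f by (simp add: in_chart_apply[OF ch])
  qed
  have sF: "smooth_on ?X ?F" and sM: "smooth_on ?X ?M"
    using N f e(1) unfolding lorentzian_harmonic_def pseudospherical_surface_def smooth_map_def by blast+
  have DF: "frechet_derivative ?F (at z) v
      = frechet_derivative \<Theta> (at (D4_model sg z)) (frechet_derivative (D4_model sg) (at z) v)"
    if z: "z \<in> ?X" for z v
  proof -
    have D4: "(D4_model sg has_derivative frechet_derivative (D4_model sg) (at z)) (at z)"
      by (rule frechet_derivative_works[THEN iffD1, OF differentiableI[OF D4_model_has_derivative]])
    have "(\<Theta> \<circ> D4_model sg has_derivative frechet_derivative \<Theta> (at (D4_model sg z))
        \<circ> frechet_derivative (D4_model sg) (at z)) (at z)"
      by (rule diff_chain_at[OF D4 smooth_on_has_derivative[OF W(2) XW[OF z]]])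
    then have "(?F has_derivative frechet_derivative \<Theta> (at (D4_model sg z))
        \<circ> frechet_derivative (D4_model sg) (at z)) (at z)"
      by (rule has_derivative_transform_within_open[OF _ X(1) z]) (simp add: F)
    from fun_cong[OF frechet_derivative_at[OF this], of v] show ?thesis by (simp only: o_apply)
  qed
  have orth: "?M z \<bullet> frechet_derivative ?F (at z) v = 0"
    and DM: "(\<And>v. frechet_derivative ?F (at z) v = 0) \<Longrightarrow> frechet_derivative ?M (at z) v = 0"
    if z: "z \<in> ?X" for z v
  proof -
    obtain q where q: "q \<in> fst e" "z = snd e q" using z by blast
    note der = pseudospherical_derivatives[OF S N f e(1) q(1)
        smooth_on_has_derivative[OF sF z, unfolded q(2)] smooth_on_has_derivative[OF sM z, unfolded q(2)]]
    show "?M z \<bullet> frechet_derivative ?F (at z) v = 0"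
      using der(1)[of v] q by (simp add: in_chart_apply[OF ch])
    show "frechet_derivative ?M (at z) v = 0" if "\<And>v. frechet_derivative ?F (at z) v = 0"
      using der(2)[of v] that q by simp
  qed
  have D40: "D4_model sg (0, 0) = 0"
    by (simp add: D4_model_def vec_eq_iff forall_3 vector_3)
  have "frechet_derivative (D4_model sg) (at (0, 0)) v = 0" for v
    using frechet_derivative_at[OF D4_model_has_derivative[of sg "(0, 0)"], symmetric]
    by (simp add: vec_eq_iff forall_3 vector_3)
  moreover have "linear (frechet_derivative \<Theta> (at 0))"
    using smooth_on_has_derivative[OF W(2) XW[OF X(2)]] has_derivative_linear by (simp add: D40)
  ultimately have "frechet_derivative ?F (at (0, 0)) v = 0" for v
    using DF[OF X(2), of v] by (simp add: D40 linear_0)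
  then have M0: "frechet_derivative ?M (at (0, 0)) v = 0" for v
    by (rule DM[OF X(2)])
  have "?M (0, 0) \<bullet> frechet_derivative \<Theta> (at 0) w = 0" for w
    by (rule no_D4_along_axis[OF X W(1,2) XW smooth_on_has_derivative[OF sM] M0])
      (use orth DF in auto)
  \<comment> \<open>The derivative of \<open>\<Theta>\<close> at \<open>0\<close> is onto, with the
    derivative of \<open>\<Phi>\<close> as a right inverse, so \<open>N p\<close> is orthogonal to
    every vector.\<close>
  moreover have "frechet_derivative \<Theta> (at 0) (frechet_derivative \<Phi> (at (f p)) w) = w" for w
    using diffeomorphism_inverse_derivative(1)[OF \<Phi> fV(1)] by (simp add: \<Theta>_def fV(2))
  ultimately have "?M (0, 0) \<bullet> w = 0" for w by metis
  then have "?M (0, 0) = 0" using inner_eq_zero_iff by blast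
  moreover have "?M (0, 0) = N p" using in_chart_apply[OF ch e(2), of N] e(3) by simp
  moreover have "norm (N p) = 1" by (rule lorentzian_harmonic_norm[OF N])
  ultimately show False by simp
qed

theorem proposition3p1:
  fixes A :: "'a::{t2_space, second_countable_topology} chart set"
    and g :: "'a metric"
    and N f :: "'a \<Rightarrow> real^3"
  assumes "lorentz_surface A g"
    and "simply_connected (UNIV :: 'a set)"
    and "lorentzian_harmonic A g N"
    and "pseudospherical_surface A g N f"
  shows "\<forall>p. \<not> D4_plus_singularity A f p \<and> \<not> D4_minus_singularity A f p"
  using pseudospherical_surface_no_D4[OF assms(1,3,4)] by blast

end
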